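(* Let $f(z)=z+\sum_{n=2}^{\infty}a_nz^n\in\mathcal{C}_1$ and let $N\ge 2$ be an integer. Then $$|f(z)|+\sum_{n=N}^{\infty}|a_nz^n|\le d(f(0),\partial f(\mathbb{D}))$$ for $|z|\le r_{1,N}$, where $r_{1,N}$ is the solution in $(0,1)$ of $$\frac{2r}{1-r}+\log(1-r)+\sum_{n=N}^{\infty}\left(2-\frac1n\right)r^{n}-(1-\log 2)=0.$$ The result is sharp, i.e. for each $N\ge2$ the number $r_{1,N}$ cannot be replaced by any larger number such that the inequality still holds for all $f\in\mathcal{C}_1$.
   Context: $\mathbb{D}=\{z\in\mathbb{C}:|z|<1\}$; $d$ is the Euclidean distance and $\partial f(\mathbb{D})$ is the boundary of $f(\mathbb{D})$. A convex function is a univalent analytic function on $\mathbb{D}$ whose image is a convex domain. The class $\mathcal{C}_1$ consists of the analytic functions $f(z)=z+\sum_{n=2}^\infty a_nz^n$ on $\mathbb{D}$ for which there exists a convex function $g(z)=b_1z+\cdots$ with $\operatorname{Re}(b_1)>0$ such that $\operatorname{Re}\left(\frac{zf'(z)}{g(z)}\right)>0$ for all $z\in\mathbb{D}$ (the quotient being extended analytically to $z=0$). *)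

theory Defs
  imports "HOL-Complex_Analysis.Complex_Analysis"
begin

text \<open>Openness and connectedness of the image are automatic for an injective
  holomorphic function with convex image, so only convexity is required.\<close>

definition convex_function :: "(complex \<Rightarrow> complex) \<Rightarrow> bool" where
  "convex_function g \<longleftrightarrow>
     g holomorphic_on ball 0 1 \<and> inj_on g (ball 0 1) \<and> convex (g ` ball 0 1)"

text \<open>Here \<open>p\<close> is the analytic extension of \<open>z f'(z) / g(z)\<close> to the origin.
  Values of \<open>f\<close> outside the open unit disc are irrelevant.\<close>

definition class_C1 :: "(complex \<Rightarrow> complex) set" where
  "class_C1 = {f. f holomorphic_on ball 0 1 \<and> f 0 = 0 \<and> deriv f 0 = 1 \<and>
     (\<exists>g p. convex_function g \<and> g 0 = 0 \<and> Re (deriv g 0) > 0 \<and>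
        p holomorphic_on ball 0 1 \<and>
        (\<forall>z\<in>ball 0 1 - {0}. p z = z * deriv f z / g z) \<and>
        (\<forall>z\<in>ball 0 1. Re (p z) > 0))}"

definition taylor_coeff :: "(complex \<Rightarrow> complex) \<Rightarrow> nat \<Rightarrow> complex" where
  "taylor_coeff f n = fps_nth (fps_expansion f 0) n"

text \<open>The tail of a series from \<open>n = N\<close> on is written with the index shifted by \<open>N\<close>.\<close>

definition bohr_ineq :: "nat \<Rightarrow> (complex \<Rightarrow> complex) \<Rightarrow> complex \<Rightarrow> bool" where
  "bohr_ineq N f z \<longleftrightarrow>
     norm (f z) + (\<Sum>n. norm (taylor_coeff f (n + N) * z ^ (n + N)))
       \<le> infdist (f 0) (frontier (f ` ball 0 1))"

definition radius_eq :: "nat \<Rightarrow> real \<Rightarrow> bool" where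
  "radius_eq N r \<longleftrightarrow>
     2 * r / (1 - r) + ln (1 - r) + (\<Sum>n. (2 - 1 / real (n + N)) * r ^ (n + N))
       - (1 - ln 2) = 0"

definition r1 :: "nat \<Rightarrow> real" where
  "r1 N = (THE r. r \<in> {0<..<1} \<and> radius_eq N r)"

end

(* Write f' = p * (g / z) with g convex and Re p > 0.  Suffridge's inequality for convex functions
   gives |1 - g'(0) z / g(z)| <= |z|, hence |g(z) / z| >= |g'(0)| / (1 + |z|) and the bound |g'(0)|
   for the coefficients of g / z.  Combined with the Caratheodory and Schwarz estimates for p this
   yields |a_n| <= 2 - 1/n and |f'(z)| >= (1 - |z|) / (1 + |z|)^2.

   The lower bound on f' gives distance at least 1 - log 2 from f(0) to the boundary by integrating
   along the preimage of a segment, once the boundary is known to be nonempty.  For this f is shown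
   to be univalent: the primitive h of g / z maps discs onto convex sets and f o h^-1 has derivative
   p o h^-1, of positive real part.  So the left-hand side of the Bohr inequality is at most
   M(r) + sum_{n >= N} (2 - 1/n) r^n with M(r) = 2r / (1 - r) + log (1 - r), and everything is sharp
   for f(z) = 2z / (1 - z) + log (1 - z), which omits its boundary value f(-1) = log 2 - 1. *)

theory Submission
  imports Defs
begin

section \<open>Functions with positive real part\<close>

text \<open>Cauchy's formula and Cauchy's theorem on the circle of radius \<open>s\<close>,
  parametrized by \<open>{0..1}\<close>. The two moments are paired below: the conjugate of the
  vanishing one is added to the coefficient integral, leaving only \<open>Re h\<close> in the
  integrand.\<close>

lemma has_integral_circle_moment:
  assumes hol: "h holomorphic_on ball 0 R" and s: "0 < s" "s < R"
  defines "E \<equiv> (\<lambda>t::real. exp (2 * of_real pi * \<i> * of_real t))"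
  shows "((\<lambda>t. h (s * E t) / E t ^ n) has_integral
           (of_real s ^ n * taylor_coeff h n)) {0..1}"
    and "n \<ge> 1 \<Longrightarrow> ((\<lambda>t. h (s * E t) * E t ^ n) has_integral 0) {0..1}"
proof -
  have sub: "cball 0 s \<subseteq> ball 0 R" using s by auto
  have path: "circlepath 0 s t = s * E t" for t
    by (simp add: circlepath E_def)
  have vd: "vector_derivative (circlepath 0 s) (at t) = 2 * pi * \<i> * s * E t" for t
    by (simp add: vector_derivative_circlepath E_def)
  have E0: "E t \<noteq> 0" for t by (simp add: E_def)
  have "((\<lambda>u. h u / (u - 0) ^ Suc n) has_contour_integral
          (2 * pi * \<i> / fact n * (deriv ^^ n) h 0)) (circlepath 0 s)"
    using s sub by (intro Cauchy_has_contour_integral_higher_derivative_circlepath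
        holomorphic_on_imp_continuous_on holomorphic_on_subset[OF hol]) auto
  then have "((\<lambda>t. h (s * E t) / (s * E t) ^ Suc n * (2 * pi * \<i> * s * E t)) has_integral
          (2 * pi * \<i> / fact n * (deriv ^^ n) h 0)) {0..1}"
    by (simp add: has_contour_integral path vd)
  from has_integral_mult_right[OF this, of "of_real s ^ n / (2 * pi * \<i>)"]
  show "((\<lambda>t. h (s * E t) / E t ^ n) has_integral
           (of_real s ^ n * taylor_coeff h n)) {0..1}"
    using s E0 by (simp add: taylor_coeff_def fps_expansion_def field_simps power_mult_distrib)
  assume n: "n \<ge> 1"
  have "((\<lambda>u. h u * u ^ (n - 1)) has_contour_integral 0) (circlepath 0 s)"
    using s by (intro Cauchy_theorem_disc_simple[where a=0 and e=R] holomorphic_intros hol)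
      (auto simp: path_image_circlepath)
  then have "((\<lambda>t. h (s * E t) * (s * E t) ^ (n - 1) * (2 * pi * \<i> * s * E t)) has_integral 0) {0..1}"
    by (simp add: has_contour_integral path vd)
  from has_integral_mult_right[OF this, of "1 / (of_real s ^ n * (2 * pi * \<i>))"]
  show "((\<lambda>t. h (s * E t) * E t ^ n) has_integral 0) {0..1}"
    using s E0 n by (cases n) (simp_all add: field_simps power_mult_distrib)
qed

text \<open>On a circle of radius \<open>s < R\<close>, \<open>s ^ n\<close> times the coefficient
  is a moment of the nonnegative function \<open>2 * Re h\<close> against a unimodular factor, and
  the mean of that function is \<open>2 * Re (h 0)\<close>. Letting \<open>s\<close> tend to
  \<open>R\<close> gives the claim, since \<open>h\<close> is controlled only on the open
  disc.\<close>

lemma Caratheodory_coefficient_bound: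
  assumes hol: "h holomorphic_on ball 0 R" and R: "0 < R"
    and pos: "\<And>z. norm z < R \<Longrightarrow> 0 \<le> Re (h z)" and n: "n \<ge> 1"
  shows "norm (taylor_coeff h n) * R ^ n \<le> 2 * Re (h 0)"
proof -
  let ?c = "taylor_coeff h n"
  have bound: "norm ?c * s ^ n \<le> 2 * Re (h 0)" if s: "0 < s" "s < R" for s :: real
  proof -
    define E where "E t = exp (2 * of_real pi * \<i> * of_real t)" for t :: real
    have nE: "norm (E t) = 1" for t by (simp add: E_def)
    have cE: "cnj (E t) = 1 / E t" for t
      using nE[of t] by (metis complex_div_cnj complex_cnj_one mult_1 div_by_1 of_real_1 power_one)
    note I = has_integral_circle_moment[OF hol s, folded E_def]
    \<comment> \<open>On the unit circle \<open>cnj (E t) = 1 / E t\<close>, so conjugating the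
      vanishing moment produces the same kernel \<open>1 / E t ^ n\<close> as in the coefficient
      integral.\<close>
    have "((cnj \<circ> (\<lambda>t. h (s * E t) * E t ^ n)) has_integral cnj 0) {0..1}"
      by (rule has_integral_cnj[THEN iffD2, OF I(2)[OF n]])
    then have "((\<lambda>t. cnj (h (s * E t)) / E t ^ n) has_integral 0) {0..1}"
      by (simp add: o_def cE power_divide)
    from has_integral_add[OF I(1)[of n] this]
    have 1: "((\<lambda>t. of_real (2 * Re (h (s * E t))) / E t ^ n) has_integral (of_real s ^ n * ?c)) {0..1}"
      by (simp add: add_divide_distrib[symmetric] complex_add_cnj)
    have "((\<lambda>t. h (s * E t)) has_integral h 0) {0..1}"
      using I(1)[of 0] by (simp add: taylor_coeff_def fps_expansion_def)
    from has_integral_linear[OF this bounded_linear_Re]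
    have "((\<lambda>t. Re (h (s * E t))) has_integral Re (h 0)) {0..1}" by (simp add: o_def)
    from has_integral_mult_right[OF this, of 2]
    have 2: "((\<lambda>t. 2 * Re (h (s * E t))) has_integral 2 * Re (h 0)) {0..1}" .
    have "norm (integral {0..1} (\<lambda>t. of_real (2 * Re (h (s * E t))) / E t ^ n))
           \<le> integral {0..1} (\<lambda>t. 2 * Re (h (s * E t)))"
    proof (rule Henstock_Kurzweil_Integration.integral_norm_bound_integral)
      fix t :: real assume "t \<in> {0..1}"
      have "0 \<le> Re (h (s * E t))" using s by (intro pos) (simp add: norm_mult nE)
      then show "norm (of_real (2 * Re (h (s * E t))) / E t ^ n) \<le> 2 * Re (h (s * E t))"
        by (simp add: norm_divide norm_power nE norm_mult del: of_real_mult)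
    qed (use 1 2 in \<open>auto simp: integrable_on_def\<close>)
    then show ?thesis
      using s integral_unique[OF 1] integral_unique[OF 2]
      by (simp add: norm_mult norm_power norm_divide mult.commute)
  qed
  have "((\<lambda>s. norm ?c * s ^ n) \<longlongrightarrow> norm ?c * R ^ n) (at_left R)"
    by (intro tendsto_intros)
  moreover have "\<forall>\<^sub>F s in at_left R. norm ?c * s ^ n \<le> 2 * Re (h 0)"
    using eventually_at_left_real[OF R] by eventually_elim (use bound in auto)
  ultimately show ?thesis by (rule tendsto_upperbound) simp
qed

text \<open>\<open>Schwarz_Lemma\<close> is applied with a strict bound; scaling \<open>f\<close> by
  \<open>t < 1\<close> provides it, and \<open>t\<close> then tends to \<open>1\<close>.\<close>

lemma Schwarz_weak:
  assumes hol: "f holomorphic_on ball 0 1" and f0: "f 0 = 0"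
    and le: "\<And>z. norm z < 1 \<Longrightarrow> norm (f z) \<le> 1" and z: "norm z < 1"
  shows "norm (f z) \<le> norm z"
proof -
  have "t * norm (f z) \<le> norm z" if t: "0 < t" "t < 1" for t :: real
  proof -
    have "norm (of_real t * f w) < 1" if "norm w < 1" for w
    proof -
      have "norm (of_real t * f w) \<le> t"
        using mult_left_mono[OF le[OF that], of t] t by (simp add: norm_mult)
      then show ?thesis using t by simp
    qed
    then have "norm ((\<lambda>w. of_real t * f w) z) \<le> norm z"
      using z by (intro Schwarz_Lemma(1)) (auto intro!: holomorphic_intros hol simp: f0)
    then show ?thesis using t by (simp add: norm_mult)
  qed
  moreover have "((\<lambda>t. t * norm (f z)) \<longlongrightarrow> 1 * norm (f z)) (at_left 1)"
    by (intro tendsto_intros)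
  moreover have "\<forall>\<^sub>F t in at_left (1::real). t \<in> {0<..<1}"
    by (rule eventually_at_left_real) simp
  ultimately show ?thesis
    by (intro tendsto_upperbound[of "\<lambda>t. t * norm (f z)" "norm (f z)" "at_left 1"])
       (auto elim!: eventually_mono)
qed

text \<open>The Moebius map \<open>?w\<close> carries the right half-plane into the disc and
  \<open>p 0\<close> to \<open>0\<close>, so the Schwarz lemma bounds \<open>p z - p 0\<close>.
  Using \<open>cnj (p 0)\<close> in the denominator covers a non-real \<open>p 0\<close>.\<close>

lemma positive_real_part_lower_bound:
  assumes hol: "p holomorphic_on ball 0 1" and pos: "\<And>z. norm z < 1 \<Longrightarrow> 0 < Re (p z)"
    and z: "norm z < 1"
  shows "norm (p 0) * (1 - norm z) \<le> norm (p z) * (1 + norm z)"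
proof -
  let ?w = "\<lambda>z. (p z - p 0) / (p z + cnj (p 0))"
  have nz: "p u + cnj (p 0) \<noteq> 0" if "norm u < 1" for u
    using pos[OF that] pos[of 0] by (auto simp: complex_eq_iff)
  have "norm (?w u) \<le> 1" if "norm u < 1" for u
  proof -
    have "(Re (p u) - Re (p 0))\<^sup>2 \<le> (Re (p u) + Re (p 0))\<^sup>2"
      using pos[OF that] pos[of 0] by (simp add: abs_le_square_iff[symmetric])
    then have "norm (p u - p 0) \<le> norm (p u + cnj (p 0))"
      by (simp add: cmod_def)
    then show ?thesis by (simp add: norm_divide divide_le_eq_1)
  qed
  then have "norm (?w z) \<le> norm z"
    using nz z by (intro Schwarz_weak[where f = ?w]) (auto intro!: holomorphic_intros hol)
  then have "norm (p z - p 0) \<le> norm z * norm (p z + cnj (p 0))"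
    using nz[OF z] by (simp add: norm_divide field_simps)
  also have "\<dots> \<le> norm z * (norm (p z) + norm (p 0))"
    by (intro mult_left_mono) (use norm_triangle_ineq[of "p z" "cnj (p 0)"] in auto)
  finally have "norm (p z - p 0) \<le> norm z * (norm (p z) + norm (p 0))" .
  moreover have "norm (p 0) - norm (p z) \<le> norm (p z - p 0)"
    by (metis norm_minus_commute norm_triangle_ineq2)
  ultimately show ?thesis by (simp add: algebra_simps)
qed

section \<open>Minimum principles and a mean value theorem for real parts\<close>

lemma Re_pos_open_mapping:
  assumes hol: "q holomorphic_on S" and S: "open S" "connected S"
    and nn: "\<And>z. z \<in> S \<Longrightarrow> 0 \<le> Re (q z)" and a: "a \<in> S" "0 < Re (q a)" and z: "z \<in> S"
  shows "0 < Re (q z)"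
proof (cases "q constant_on S")
  case True
  then show ?thesis using a z by (auto simp: constant_on_def)
next
  case False
  have op: "open (q ` S)" using open_mapping_thm[OF hol S S(1) order_refl False] .
  show ?thesis
  proof (rule ccontr)
    assume "\<not> ?thesis"
    with nn[OF z] have 0: "Re (q z) = 0" by simp
    from op z obtain e where e: "e > 0" "ball (q z) e \<subseteq> q ` S"
      by (auto simp: open_contains_ball)
    have "q z - of_real (e/2) \<in> ball (q z) e" using e by (simp add: dist_norm norm_minus_commute)
    then obtain u where u: "u \<in> S" "q u = q z - of_real (e/2)" using e(2) by (metis imageE subsetD)
    then have "Re (q u) < 0" using 0 e by simp
    then show False using nn[OF u(1)] by simp
  qed
qed

text \<open>The modulus of \<open>exp (- F z)\<close> is \<open>exp (- Re (F z))\<close>, so the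
  maximum modulus principle for it is a minimum principle for \<open>Re F\<close>.\<close>

lemma Re_nonneg_ball_from_sphere:
  assumes hol: "F holomorphic_on S" and sub: "cball 0 \<rho> \<subseteq> S"
    and nn: "\<And>z. norm z = \<rho> \<Longrightarrow> 0 \<le> Re (F z)" and z: "norm z \<le> \<rho>"
  shows "0 \<le> Re (F z)"
proof -
  have "norm (exp (- F z)) \<le> 1"
  proof (rule maximum_modulus_frontier[of "\<lambda>z. exp (- F z)" "cball 0 \<rho>" 1 z])
    show "(\<lambda>z. exp (- F z)) holomorphic_on interior (cball 0 \<rho>)"
      using sub by (intro holomorphic_intros holomorphic_on_subset[OF hol]) auto
    show "continuous_on (closure (cball 0 \<rho>)) (\<lambda>z. exp (- F z))"
      using sub by (intro holomorphic_on_imp_continuous_on holomorphic_intros holomorphic_on_subset[OF hol]) auto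
  qed (use nn z in \<open>auto simp: frontier_cball\<close>)
  then show ?thesis by simp
qed

text \<open>The mean value theorem fails for complex values, but dividing by \<open>b - a\<close>
  before taking real parts reduces the claim to the real theorem along the segment. It transfers the
  sign of \<open>Re m'\<close> to difference quotients.\<close>

lemma mvt_Re_slope:
  assumes S: "convex S" and ab: "a \<in> S" "b \<in> S" "a \<noteq> b"
    and der: "\<And>w. w \<in> S \<Longrightarrow> (m has_field_derivative m' w) (at w)"
  obtains c where "c \<in> S" "Re ((m b - m a) / (b - a)) = Re (m' c)"
proof -
  define w where "w = (\<lambda>t::real. a + of_real t * (b - a))"
  define v where "v = (\<lambda>t. Re (m (w t) / (b - a)))"
  have wS: "w t \<in> S" if "0 \<le> t" "t \<le> 1" for t
  proof -
    have "w t = (1 - t) *\<^sub>R a + t *\<^sub>R b" by (simp add: w_def scaleR_conv_of_real algebra_simps)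
    then show ?thesis using convexD_alt[OF S ab(1,2) that] by simp
  qed
  have d: "(v has_real_derivative Re (m' (w t))) (at t)" if "0 \<le> t" "t \<le> 1" for t
  proof -
    have 1: "(w has_vector_derivative (b - a)) (at t)"
      unfolding w_def by (auto intro!: derivative_eq_intros)
    have "((\<lambda>z. m z / (b - a)) has_field_derivative m' (w t) / (b - a)) (at (w t))"
      using der[OF wS[OF that]] by (rule DERIV_cdivide)
    from field_vector_diff_chain_at[OF 1 this]
    have "((\<lambda>t. m (w t) / (b - a)) has_vector_derivative m' (w t)) (at t)"
      using ab by (simp add: o_def)
    then show ?thesis
      unfolding v_def has_real_derivative_iff_has_vector_derivative
      by (rule bounded_linear.has_vector_derivative[OF bounded_linear_Re])
  qed
  have "\<exists>t>0. t < 1 \<and> v 1 - v 0 = (1 - 0) * Re (m' (w t))"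
    by (rule MVT2) (use d in auto)
  then obtain t where t: "0 < t" "t < 1" "v 1 - v 0 = Re (m' (w t))" by auto
  moreover have "v 1 - v 0 = Re ((m b - m a) / (b - a))"
    by (simp add: v_def w_def diff_divide_distrib)
  ultimately show ?thesis using wS[of t] that by auto
qed

section \<open>Convex functions\<close>

lemma convex_functionD:
  assumes "convex_function g"
  shows "g holomorphic_on ball 0 1" "inj_on g (ball 0 1)" "convex (g ` ball 0 1)"
    "open (g ` ball 0 1)"
    "norm z < 1 \<Longrightarrow> deriv g z \<noteq> 0"
  using assms open_mapping_thm3[of g "ball 0 1"] holomorphic_injective_imp_regular[of g "ball 0 1" z]
  by (auto simp: convex_function_def)

lemma holomorphic_on_comp:
  assumes "f holomorphic_on S" "g holomorphic_on T" "\<And>x. x \<in> S \<Longrightarrow> f x \<in> T"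
  shows "(\<lambda>x. g (f x)) holomorphic_on S"
  using holomorphic_on_compose_gen[OF assms(1,2)] assms(3) by (auto simp: o_def)

text \<open>Study's argument: by convexity of the image and the Schwarz lemma, moving \<open>g z\<close> towards
  \<open>g (\<kappa> * z)\<close> does not increase the modulus of the preimage; the claim is the derivative of
  this at the starting point.\<close>

lemma convex_function_rotation:
  assumes g: "convex_function g" and z: "norm z < 1" "z \<noteq> 0" and \<kappa>: "norm \<kappa> = 1"
  shows "0 \<le> Re ((g z - g (\<kappa> * z)) / (z * deriv g z))"
proof -
  note g' = convex_functionD[OF g]
  obtain \<phi> where \<phi>: "\<phi> holomorphic_on g ` ball 0 1"
      "\<And>z. z \<in> ball 0 1 \<Longrightarrow> deriv g z * deriv \<phi> (g z) = 1"
      "\<And>z. z \<in> ball 0 1 \<Longrightarrow> \<phi> (g z) = z"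
    using holomorphic_has_inverse[OF g'(1) open_ball g'(2)] by metis
  define c where "c t = \<phi> (g z + of_real t * (g (\<kappa> * z) - g z))" for t :: real
  define v where "v = deriv \<phi> (g z) * (g (\<kappa> * z) - g z)"
  have dg0: "deriv g z \<noteq> 0" using \<phi>(2)[of z] z by auto
  then have dg: "deriv g z \<noteq> 0" "deriv \<phi> (g z) = 1 / deriv g z"
    using \<phi>(2)[of z] z by (auto simp: eq_divide_eq mult.commute)
  have rot: "(\<lambda>u. g (\<kappa> * u)) holomorphic_on ball 0 1"
    using \<kappa> by (intro holomorphic_on_comp[OF _ g'(1)] holomorphic_intros) (simp add: norm_mult)
  have le: "norm (c t) \<le> norm z" if t: "0 \<le> t" "t \<le> 1" for t
  proof -
    \<comment> \<open>The parameter \<open>t\<close> is frozen and the Schwarz lemma is applied in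
      \<open>u\<close>: the map \<phi> composed with \<open>m\<close> is a self-map of the disc
      fixing \<open>0\<close>, and \<open>c t\<close> is its value at \<open>z\<close>.\<close>
    define m where "m u = g u + of_real t * (g (\<kappa> * u) - g u)" for u
    have m: "m u \<in> g ` ball 0 1" if "u \<in> ball 0 1" for u
    proof -
      have "m u = (1 - t) *\<^sub>R g u + t *\<^sub>R g (\<kappa> * u)"
        by (simp add: m_def scaleR_conv_of_real algebra_simps)
      then show ?thesis
        using convexD_alt[OF g'(3) _ _ t] that \<kappa> by (simp add: norm_mult)
    qed
    have "m holomorphic_on ball 0 1" unfolding m_def by (intro holomorphic_intros rot g')
    then have "(\<lambda>u. \<phi> (m u)) holomorphic_on ball 0 1"
      using m by (rule holomorphic_on_comp[OF _ \<phi>(1)])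
    moreover have "norm (\<phi> (m u)) < 1" if "norm u < 1" for u
      using m[of u] \<phi>(3) that by auto
    moreover have "\<phi> (m 0) = 0" using \<phi>(3)[of 0] by (simp add: m_def)
    ultimately have "norm (\<phi> (m z)) \<le> norm z"
      using z by (intro Schwarz_Lemma(1)[where f = "\<lambda>u. \<phi> (m u)"]) auto
    then show ?thesis by (simp add: c_def m_def)
  qed
  have c0: "c 0 = z" using \<phi>(3)[of z] z by (simp add: c_def)
  have "(c has_vector_derivative v) (at 0)"
  proof -
    have 1: "((\<lambda>t::real. g z + of_real t * (g (\<kappa> * z) - g z)) has_vector_derivative (g (\<kappa> * z) - g z)) (at 0)"
      by (auto intro!: derivative_eq_intros)
    have "(\<phi> has_field_derivative deriv \<phi> (g z)) (at (g z + of_real 0 * (g (\<kappa> * z) - g z)))"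
      using holomorphic_derivI[OF \<phi>(1) g'(4), of "g z"] z by simp
    from field_vector_diff_chain_at[OF 1 this] show ?thesis
      by (simp add: o_def c_def[abs_def] v_def mult.commute)
  qed
  from bounded_bilinear.has_vector_derivative[OF bounded_bilinear_inner this this]
  have der: "DERIV (\<lambda>t. inner (c t) (c t)) 0 :> 2 * inner z v"
    by (simp add: has_real_derivative_iff_has_vector_derivative c0 inner_commute)
  have "inner z v \<le> 0"
  proof (rule ccontr)
    assume "\<not> inner z v \<le> 0"
    then have "0 < 2 * inner z v" by simp
    from DERIV_pos_inc_right[OF der this] obtain d where
      d: "d > 0" "\<And>h. 0 < h \<Longrightarrow> h < d \<Longrightarrow> inner (c 0) (c 0) < inner (c h) (c h)" by auto
    define h where "h = min (d/2) 1"
    have h: "0 < h" "h < d" "h \<le> 1" using d by (auto simp: h_def min_def)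
    have "inner z z < inner (c h) (c h)" using d(2)[OF h(1,2)] by (simp add: c0)
    moreover have "(norm (c h))\<^sup>2 \<le> (norm z)\<^sup>2" using le[of h] h by (intro power_mono) auto
    ultimately show False by (simp add: dot_square_norm)
  qed
  moreover have "(g z - g (\<kappa> * z)) / (z * deriv g z) = - (v / z)"
    using z dg by (simp add: v_def field_simps)
  moreover have "Re (v / z) = inner z v / (norm z)\<^sup>2"
    by (simp add: Re_divide inner_complex_def cmod_power2 mult.commute)
  ultimately show ?thesis by (simp add: divide_nonpos_nonneg)
qed

lemma Re_inverse_nonneg: "0 \<le> Re (w::complex) \<Longrightarrow> 0 \<le> Re (1 / w)"
  by (simp add: Re_divide)

text \<open>The function \<open>F z = 2 z g'(z) / (g z - g \<zeta>) - (z + \<zeta>) / (z - \<zeta>)\<close> has a removable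
  singularity at \<open>\<zeta>\<close>, and its second term is purely imaginary on the circle through \<open>\<zeta>\<close>, so
  that \<open>Re F \<ge> 0\<close> in the disc. The claim is the coefficient bound \<open>\<bar>F'(0)\<bar> * \<bar>\<zeta>\<bar> \<le> 2\<close>.\<close>

lemma convex_function_disc_bound:
  assumes g: "convex_function g" "g 0 = 0" and \<zeta>: "norm \<zeta> < 1" "\<zeta> \<noteq> 0"
  shows "norm (1 - deriv g 0 * \<zeta> / g \<zeta>) \<le> 1"
proof -
  note g' = convex_functionD[OF g(1)]
  define s where "s z = (if z = \<zeta> then deriv g \<zeta> else (g z - g \<zeta>) / (z - \<zeta>))" for z
  \<comment> \<open>Clearing the pole at \<zeta>: the quotient \<open>s\<close> has no zeros,
    \<open>n\<close> vanishes at \<zeta>, and \<open>F\<close> is \<open>n\<close> divided by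
    \<open>z - \<zeta>\<close>.\<close>
  define n where "n z = 2 * z * deriv g z / s z - (z + \<zeta>)" for z
  define F where "F z = (if z = \<zeta> then deriv n \<zeta> else (n z - n \<zeta>) / (z - \<zeta>))" for z
  have gne: "g z \<noteq> g \<zeta>" if "z \<in> ball 0 1" "z \<noteq> \<zeta>" for z
    using inj_onD[OF g'(2), of z \<zeta>] that \<zeta> by auto
  have g\<zeta>: "g \<zeta> \<noteq> 0" using gne[of 0] g(2) \<zeta> by auto
  have int: "\<zeta> \<in> interior (ball 0 1)" using \<zeta> by simp
  have s: "s holomorphic_on ball 0 1"
    using pole_lemma[OF g'(1) int] by (simp add: s_def[abs_def])
  have s0: "s z \<noteq> 0" if "z \<in> ball 0 1" for z
    using gne[OF that] g'(5)[of z] that by (auto simp: s_def)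
  have n: "n holomorphic_on ball 0 1"
    unfolding n_def using s0 by (intro holomorphic_intros s g'(1)) auto
  have n0: "n \<zeta> = 0" using s0[of \<zeta>] \<zeta> by (simp add: n_def s_def)
  have F: "F holomorphic_on ball 0 1"
    using pole_lemma[OF n int] by (simp add: F_def[abs_def])
  have Feq: "F z = 2 * z * deriv g z / (g z - g \<zeta>) - (z + \<zeta>) / (z - \<zeta>)"
    if "z \<in> ball 0 1" "z \<noteq> \<zeta>" for z
  proof -
    have "F z = n z / (z - \<zeta>)" using that by (simp add: F_def n0)
    also have "\<dots> = 2 * z * deriv g z / (s z * (z - \<zeta>)) - (z + \<zeta>) / (z - \<zeta>)"
      by (simp add: n_def diff_divide_distrib)
    also have "s z * (z - \<zeta>) = g z - g \<zeta>" using that by (simp add: s_def)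
    finally show ?thesis .
  qed
  have pos': "0 \<le> Re (F z)" if z: "norm z = norm \<zeta>" "z \<noteq> \<zeta>" for z
  proof -
    define q where "q = z * deriv g z / (g z - g \<zeta>)"
    have z0: "z \<noteq> 0" "norm z < 1" using z \<zeta> by auto
    \<comment> \<open>The unimodular factor \<open>\<zeta> / z\<close> rotates \<open>z\<close> onto
      \<zeta>.\<close>
    have "0 \<le> Re ((g z - g (\<zeta> / z * z)) / (z * deriv g z))"
      using z z0 by (intro convex_function_rotation g) (auto simp: norm_divide)
    then have "0 \<le> Re (1 / ((g z - g \<zeta>) / (z * deriv g z)))"
      using z0 by (intro Re_inverse_nonneg) simp
    then have 1: "0 \<le> Re q" by (simp add: q_def)
    have "Re ((z + \<zeta>) * cnj (z - \<zeta>)) = (norm z)\<^sup>2 - (norm \<zeta>)\<^sup>2"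
      by (simp add: cmod_power2) (simp add: algebra_simps power2_eq_square)
    then have "Re ((z + \<zeta>) / (z - \<zeta>)) = 0"
      using z(1) complex_div_cnj[of "z + \<zeta>" "z - \<zeta>"] by (simp add: Re_divide_of_real flip: of_real_power)
    moreover have "F z = 2 * q - (z + \<zeta>) / (z - \<zeta>)"
      using Feq[of z] z0 z by (simp add: q_def mult.assoc)
    ultimately show ?thesis using 1 by simp
  qed
  have pos: "0 \<le> Re (F z)" if z: "norm z = norm \<zeta>" for z
  proof (cases "z = \<zeta>")
    case True
    have "continuous_on (ball 0 1) F" using F by (rule holomorphic_on_imp_continuous_on)
    then have "isCont F \<zeta>" using \<zeta> by (simp add: continuous_on_eq_continuous_at)
    moreover have "((\<lambda>t. \<zeta> * cis t) \<longlongrightarrow> \<zeta> * cis 0) (at_right 0)"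
      by (intro tendsto_intros)
    ultimately have "((\<lambda>t. F (\<zeta> * cis t)) \<longlongrightarrow> F \<zeta>) (at_right 0)"
      by (intro isCont_tendsto_compose[of \<zeta> F]) auto
    then have lim: "((\<lambda>t. Re (F (\<zeta> * cis t))) \<longlongrightarrow> Re (F \<zeta>)) (at_right 0)"
      by (intro tendsto_intros)
    have "\<forall>\<^sub>F t in at_right 0. t \<in> {0<..<pi}"
      by (rule eventually_at_right_real) simp
    then have "\<forall>\<^sub>F t in at_right 0. 0 \<le> Re (F (\<zeta> * cis t))"
    proof eventually_elim
      case (elim t)
      then have "cis t \<noteq> 1" using sin_gt_zero[of t] by (auto simp: complex_eq_iff)
      then show ?case using \<zeta> by (intro pos') (auto simp: norm_mult)
    qed
    from tendsto_lowerbound[OF lim this] True show ?thesis by simp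
  qed (use pos' z in auto)
  have nn: "0 \<le> Re (F z)" if "norm z < norm \<zeta>" for z
    by (rule Re_nonneg_ball_from_sphere[OF F _ pos]) (use that \<zeta> in auto)
  have F0: "F 0 = 1" using Feq[of 0] \<zeta> by simp
  have "norm (taylor_coeff F 1) * norm \<zeta> ^ 1 \<le> 2 * Re (F 0)"
    using \<zeta> nn by (intro Caratheodory_coefficient_bound holomorphic_on_subset[OF F]) auto
  then have 1: "norm (deriv F 0) * norm \<zeta> \<le> 2" by (simp add: F0 taylor_coeff_def fps_expansion_def)
  have "deriv F 0 = 2 / \<zeta> - 2 * deriv g 0 / g \<zeta>"
  proof (rule DERIV_imp_deriv)
    have dg: "(g has_field_derivative deriv g 0) (at 0)"
      using holomorphic_derivI[OF g'(1) open_ball] by simp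
    have ddg: "(deriv g has_field_derivative deriv (deriv g) 0) (at 0)"
      using holomorphic_derivI[OF holomorphic_deriv[OF g'(1) open_ball] open_ball] by simp
    have "((\<lambda>z. 2 * z * deriv g z / (g z - g \<zeta>) - (z + \<zeta>) / (z - \<zeta>)) has_field_derivative
        (2 / \<zeta> - 2 * deriv g 0 / g \<zeta>)) (at 0)"
      using \<zeta> g\<zeta> by (auto intro!: derivative_eq_intros dg ddg simp: g(2) field_simps power2_eq_square)
    then show "(F has_field_derivative (2 / \<zeta> - 2 * deriv g 0 / g \<zeta>)) (at 0)"
      by (rule has_field_derivative_transform_within_open[where S = "ball 0 1 - {\<zeta>}"])
         (use \<zeta> Feq in \<open>auto intro: open_Diff\<close>)
  qed
  then have "deriv F 0 * \<zeta> = 2 * (1 - deriv g 0 * \<zeta> / g \<zeta>)"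
    using \<zeta> g\<zeta> by (simp add: field_simps)
  then have "norm (deriv F 0) * norm \<zeta> = 2 * norm (1 - deriv g 0 * \<zeta> / g \<zeta>)"
    by (metis norm_mult norm_numeral)
  with 1 show ?thesis by simp
qed

section \<open>The quotient g(z)/z of a convex function\<close>

definition quot0 :: "(complex \<Rightarrow> complex) \<Rightarrow> complex \<Rightarrow> complex" where
  "quot0 g z = (if z = 0 then deriv g 0 else g z / z)"

lemma quot0_holomorphic:
  assumes "g holomorphic_on ball 0 1" "g 0 = 0"
  shows "quot0 g holomorphic_on ball 0 1"
  using pole_lemma[OF assms(1), of 0] assms(2) by (simp add: quot0_def[abs_def] cong: if_cong)

lemma quot0_nonzero:
  assumes g: "convex_function g" "g 0 = 0" and z: "norm z < 1"
  shows "quot0 g z \<noteq> 0"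
  using inj_onD[OF convex_functionD(2)[OF g(1)], of z 0] convex_functionD(5)[OF g(1) z] g(2) z
  by (auto simp: quot0_def)

text \<open>The bound \<open>1\<close> from \<open>convex_function_disc_bound\<close> holds for a
  holomorphic function vanishing at \<open>0\<close>, so the Schwarz lemma sharpens it to
  \<open>norm z\<close>.\<close>

lemma quot0_disc:
  assumes g: "convex_function g" "g 0 = 0" and z: "norm z < 1"
  shows "norm (1 - deriv g 0 / quot0 g z) \<le> norm z"
proof (rule Schwarz_weak[where f = "\<lambda>z. 1 - deriv g 0 / quot0 g z"])
  show "(\<lambda>z. 1 - deriv g 0 / quot0 g z) holomorphic_on ball 0 1"
    using quot0_nonzero[OF g] by (intro holomorphic_intros quot0_holomorphic convex_functionD g) auto
  show "1 - deriv g 0 / quot0 g 0 = 0"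
    using convex_functionD(5)[OF g(1), of 0] by (simp add: quot0_def)
  show "norm (1 - deriv g 0 / quot0 g z) \<le> 1" if "norm z < 1" for z
  proof (cases "z = 0")
    case False
    then show ?thesis using convex_function_disc_bound[OF g that] by (simp add: quot0_def)
  qed (use convex_functionD(5)[OF g(1), of 0] in \<open>simp add: quot0_def\<close>)
qed (rule z)

lemma quot0_lower_bound:
  assumes g: "convex_function g" "g 0 = 0" and z: "norm z < 1"
  shows "norm (deriv g 0) \<le> norm (quot0 g z) * (1 + norm z)"
proof -
  let ?x = "deriv g 0 / quot0 g z"
  have "norm ?x \<le> 1 + norm z"
    using quot0_disc[OF assms] norm_triangle_ineq2[of ?x 1] by (simp add: norm_minus_commute)
  then show ?thesis using quot0_nonzero[OF assms] by (simp add: norm_divide field_simps)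
qed

text \<open>Multiplying by \<open>norm x\<close> turns the hypothesis into
  \<open>norm (x - 1) < norm x\<close>: \<open>x\<close> is closer to \<open>1\<close> than to
  \<open>0\<close>.\<close>

lemma Re_gt_half:
  assumes "norm (1 - 1 / x) < 1" "x \<noteq> (0::complex)"
  shows "0 < Re (2 * x - 1)"
proof -
  have "norm (x - 1) < norm x"
  proof -
    have "x - 1 = (1 - 1 / x) * x" using assms by (simp add: field_simps)
    then have "norm (x - 1) = norm (1 - 1 / x) * norm x" by (metis norm_mult)
    then show ?thesis using mult_strict_right_mono[OF assms(1), of "norm x"] assms(2) by simp
  qed
  then have "(norm (x - 1))\<^sup>2 < (norm x)\<^sup>2" by (intro power_strict_mono) auto
  then show ?thesis by (simp add: cmod_power2) (simp add: power2_eq_square algebra_simps)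
qed

lemma taylor_coeff_eqI: "f has_fps_expansion F \<Longrightarrow> taylor_coeff f n = fps_nth F n"
  by (simp add: taylor_coeff_def fps_expansion_eqI)

lemma has_fps_expansion_taylor:
  "f holomorphic_on ball 0 1 \<Longrightarrow> f has_fps_expansion fps_expansion f 0"
  by (rule has_fps_expansion_fps_expansion[of "ball 0 1"]) auto

text \<open>By \<open>quot0_disc\<close> and \<open>Re_gt_half\<close>,
  \<open>2 / deriv g 0 * quot0 g - 1\<close> has positive real part and value \<open>1\<close> at
  \<open>0\<close>. The Caratheodory bound \<open>2\<close> for it cancels the factor
  \<open>2\<close>.\<close>

lemma quot0_coeff_bound:
  assumes g: "convex_function g" "g 0 = 0"
  shows "norm (taylor_coeff (quot0 g) n) \<le> norm (deriv g 0)"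
proof (cases "n = 0")
  case True
  then show ?thesis by (simp add: taylor_coeff_def fps_expansion_def quot0_def)
next
  case False
  let ?b = "deriv g 0" and ?k = "quot0 g"
  have b: "?b \<noteq> 0" using convex_functionD(5)[OF g(1), of 0] by simp
  have k: "?k holomorphic_on ball 0 1" by (intro quot0_holomorphic convex_functionD g)
  define h where "h = (\<lambda>z. 2 / ?b * ?k z - 1)"
  have "0 \<le> Re (h z)" if z: "norm z < 1" for z
  proof -
    have "norm (1 - 1 / (?k z / ?b)) < 1" using quot0_disc[OF g z] z by simp
    from Re_gt_half[OF this] show ?thesis using quot0_nonzero[OF g z] b by (simp add: h_def)
  qed
  then have "norm (taylor_coeff h n) * 1 ^ n \<le> 2 * Re (h 0)"
    using False by (intro Caratheodory_coefficient_bound)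
      (auto simp: h_def intro!: holomorphic_intros k)
  also have "Re (h 0) = 1" using b by (simp add: h_def quot0_def)
  also have "taylor_coeff h n = 2 / ?b * taylor_coeff ?k n"
  proof -
    have "h has_fps_expansion (fps_const (2 / ?b) * fps_expansion ?k 0 - 1)"
      unfolding h_def by (intro fps_expansion_intros has_fps_expansion_taylor k)
    from taylor_coeff_eqI[OF this] False show ?thesis
      by (simp add: taylor_coeff_def)
  qed
  finally show ?thesis using b by (simp add: norm_mult norm_divide field_simps)
qed

section \<open>Coefficients and derivative in the class\<close>

text \<open>The definition relates \<open>f'\<close>, \<open>p\<close> and \<open>g\<close> only
  away from the origin; continuity of the difference \<open>D\<close> extends the product formula to
  \<open>0\<close>.\<close>

lemma class_C1E:
  assumes "f \<in> class_C1"
  obtains g p where "convex_function g" "g 0 = 0" "p holomorphic_on ball 0 1"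
    "\<And>z. norm z < 1 \<Longrightarrow> 0 < Re (p z)"
    "\<And>z. norm z < 1 \<Longrightarrow> deriv f z = p z * quot0 g z"
proof -
  from assms obtain g p where f: "f holomorphic_on ball 0 1"
    and g: "convex_function g" "g 0 = 0" and p: "p holomorphic_on ball 0 1"
      "\<And>z. norm z < 1 \<Longrightarrow> 0 < Re (p z)"
    and eq: "\<And>z. norm z < 1 \<Longrightarrow> z \<noteq> 0 \<Longrightarrow> p z = z * deriv f z / g z"
    unfolding class_C1_def by auto
  define D where "D z = deriv f z - p z * quot0 g z" for z
  have D: "D holomorphic_on ball 0 1"
    unfolding D_def by (intro holomorphic_intros f p quot0_holomorphic convex_functionD g) auto
  have D0: "D z = 0" if "norm z < 1" "z \<noteq> 0" for z
    using eq[OF that] quot0_nonzero[OF g that(1)] that by (simp add: D_def quot0_def)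
  have "isCont D 0"
    using holomorphic_on_imp_continuous_on[OF D] by (simp add: continuous_on_eq_continuous_at)
  then have "D \<midarrow>0\<rightarrow> D 0" by (simp add: isCont_def)
  moreover have "D \<midarrow>0\<rightarrow> 0"
  proof (rule tendsto_eventually)
    show "\<forall>\<^sub>F z in at 0. D z = 0"
      unfolding eventually_at by (rule exI[of _ 1]) (auto simp: D0)
  qed
  ultimately have "D 0 = 0" by (rule LIM_unique)
  with D0 have "deriv f z = p z * quot0 g z" if "norm z < 1" for z
    using that by (cases "z = 0") (auto simp: D_def)
  with that g p show ?thesis by blast
qed

lemma taylor_coeff_deriv:
  "taylor_coeff (deriv f) n = of_nat (Suc n) * taylor_coeff f (Suc n)"
  by (simp add: taylor_coeff_def fps_expansion_def funpow_swap1 field_simps del: of_nat_Suc)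

text \<open>In the Cauchy product for \<open>f' = p * quot0 g\<close>, the term with the constant
  coefficient of \<open>p\<close> is at most \<open>1\<close> in modulus and each of the other
  \<open>n\<close> terms at most \<open>2\<close>. The total \<open>2 * n + 1\<close> is then
  divided by \<open>n + 1\<close>.\<close>

lemma class_C1_coeff_bound:
  assumes f: "f \<in> class_C1"
  shows "norm (taylor_coeff f (Suc n)) \<le> 2 - 1 / real (Suc n)"
proof -
  obtain g p where g: "convex_function g" "g 0 = 0" and p: "p holomorphic_on ball 0 1"
    "\<And>z. norm z < 1 \<Longrightarrow> 0 < Re (p z)"
    and eq: "\<And>z. norm z < 1 \<Longrightarrow> deriv f z = p z * quot0 g z"
    by (rule class_C1E[OF f]) (rule that)
  let ?b = "deriv g 0" and ?k = "quot0 g"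
  have f0: "deriv f 0 = 1" using f by (simp add: class_C1_def)
  \<comment> \<open>The normalization \<open>f'(0) = 1\<close> makes the two unknown scales cancel
    in every product below.\<close>
  have pb: "norm (p 0) * norm ?b = 1"
    using eq[of 0] f0 by (simp add: quot0_def flip: norm_mult)
  have k: "?k holomorphic_on ball 0 1" by (intro quot0_holomorphic convex_functionD g)
  have A: "(\<lambda>z. p z * ?k z) has_fps_expansion fps_expansion p 0 * fps_expansion ?k 0"
    by (intro fps_expansion_intros has_fps_expansion_taylor p k)
  have B: "\<forall>\<^sub>F z in nhds 0. p z * ?k z = deriv f z"
    unfolding eventually_nhds by (rule exI[of _ "ball 0 1"]) (auto simp: eq)
  have "deriv f has_fps_expansion fps_expansion p 0 * fps_expansion ?k 0"
    using A has_fps_expansion_cong[OF B refl] by simp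
  from taylor_coeff_eqI[OF this]
  have "taylor_coeff (deriv f) n = (\<Sum>i=0..n. taylor_coeff p i * taylor_coeff ?k (n - i))"
    by (simp add: fps_mult_nth taylor_coeff_def)
  then have "norm (taylor_coeff (deriv f) n) \<le> (\<Sum>i=0..n. norm (taylor_coeff p i) * norm (taylor_coeff ?k (n - i)))"
    by (simp add: sum_norm_le norm_mult)
  also have "\<dots> \<le> (\<Sum>i=0..n. if i = 0 then 1 else 2)"
  proof (rule sum_mono)
    fix i
    have "norm (taylor_coeff p i) \<le> norm (p 0) * (if i = 0 then 1 else 2)"
    proof (cases "i = 0")
      case True
      then show ?thesis by (simp add: taylor_coeff_def fps_expansion_def)
    next
      case False
      then have "norm (taylor_coeff p i) * 1 ^ i \<le> 2 * Re (p 0)"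
        by (intro Caratheodory_coefficient_bound p) (auto intro: less_imp_le[OF p(2)])
      then show ?thesis using complex_Re_le_cmod[of "p 0"] False by simp
    qed
    then have "norm (taylor_coeff p i) * norm (taylor_coeff ?k (n - i))
        \<le> (norm (p 0) * (if i = 0 then 1 else 2)) * norm ?b"
      using quot0_coeff_bound[OF g] by (intro mult_mono) auto
    also have "\<dots> = (norm (p 0) * norm ?b) * (if i = 0 then 1 else 2)"
      by (simp only: mult_ac)
    finally show "norm (taylor_coeff p i) * norm (taylor_coeff ?k (n - i)) \<le> (if i = 0 then 1 else 2)"
      by (simp add: pb)
  qed
  also have "\<dots> = 2 * real n + 1" by (simp add: sum.atLeast0_atMost_Suc_shift sum.atLeast_Suc_atMost)
  finally have "real (Suc n) * norm (taylor_coeff f (Suc n)) \<le> 2 * real n + 1"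
    unfolding taylor_coeff_deriv norm_mult norm_of_nat .
  then show ?thesis by (simp add: field_simps)
qed

lemma class_C1_deriv_lower_bound:
  assumes f: "f \<in> class_C1" and z: "norm z < 1"
  shows "(1 - norm z) / (1 + norm z)\<^sup>2 \<le> norm (deriv f z)"
proof -
  obtain g p where g: "convex_function g" "g 0 = 0" and p: "p holomorphic_on ball 0 1"
    "\<And>z. norm z < 1 \<Longrightarrow> 0 < Re (p z)"
    and eq: "\<And>z. norm z < 1 \<Longrightarrow> deriv f z = p z * quot0 g z"
    by (rule class_C1E[OF f]) (rule that)
  have f0: "deriv f 0 = 1" using f by (simp add: class_C1_def)
  have pb: "norm (p 0) * norm (deriv g 0) = 1"
    using eq[of 0] f0 by (simp add: quot0_def flip: norm_mult)
  have "(norm (p 0) * (1 - norm z)) * norm (deriv g 0)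
      \<le> (norm (p z) * (1 + norm z)) * (norm (quot0 g z) * (1 + norm z))"
    by (rule mult_mono[OF positive_real_part_lower_bound[OF p z] quot0_lower_bound[OF g z]]) auto
  also have "\<dots> = norm (deriv f z) * (1 + norm z)\<^sup>2"
    by (simp add: eq[OF z] norm_mult power2_eq_square mult_ac)
  also have "(norm (p 0) * (1 - norm z)) * norm (deriv g 0) = (norm (p 0) * norm (deriv g 0)) * (1 - norm z)"
    by (simp only: mult_ac)
  finally have "1 - norm z \<le> norm (deriv f z) * (1 + norm z)\<^sup>2" by (simp add: pb)
  moreover have "0 < (1 + norm z)\<^sup>2" by (intro zero_less_power) (smt (verit) norm_ge_zero)
  ultimately show ?thesis by (simp add: pos_divide_le_eq)
qed

section \<open>Univalence\<close>

text \<open>For fixed \<open>z\<close> the quotient is holomorphic in \<kappa> on a disc of radius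
  \<open>1 / norm z > 1\<close>, so the minimum principle extends the rotation inequality from the
  unit circle inward.\<close>

lemma convex_function_contraction:
  assumes g: "convex_function g" and z: "norm z < 1" "z \<noteq> 0" and \<kappa>: "norm \<kappa> \<le> 1"
  shows "0 \<le> Re ((g z - g (\<kappa> * z)) / (z * deriv g z))"
proof -
  let ?S = "ball 0 (1 / norm z)"
  have "(\<lambda>\<kappa>. g (\<kappa> * z)) holomorphic_on ?S"
    using z by (intro holomorphic_on_comp[OF _ convex_functionD(1)[OF g]] holomorphic_intros)
      (simp add: norm_mult field_simps)
  then have "(\<lambda>\<kappa>. (g z - g (\<kappa> * z)) / (z * deriv g z)) holomorphic_on ?S"
    using z convex_functionD(5)[OF g z(1)] by (intro holomorphic_intros) auto
  moreover have "1 < 1 / norm z" using z by simp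
  then have "cball 0 1 \<subseteq> ?S" by auto
  ultimately show ?thesis
    by (rule Re_nonneg_ball_from_sphere[OF _ _ convex_function_rotation[OF g z] \<kappa>])
qed

lemma Re_one_minus_pos: "norm \<kappa> \<le> 1 \<Longrightarrow> \<kappa> \<noteq> 1 \<Longrightarrow> 0 < Re (1 - \<kappa>)"
proof -
  assume a: "norm \<kappa> \<le> 1" "\<kappa> \<noteq> 1"
  have "Re \<kappa> \<noteq> 1"
  proof
    assume "Re \<kappa> = 1"
    moreover from a have "(Re \<kappa>)\<^sup>2 + (Im \<kappa>)\<^sup>2 \<le> 1"
      by (metis cmod_power2 norm_ge_zero power_le_one)
    ultimately show False using a(2) by (simp add: complex_eq_iff)
  qed
  then show ?thesis using complex_Re_le_cmod[of \<kappa>] a by simp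
qed

lemma holomorphic_on_if_deriv:
  assumes "\<And>z. norm z < 1 \<Longrightarrow> (h has_field_derivative h' z) (at z)"
  shows "h holomorphic_on ball 0 1"
  by (subst holomorphic_on_open[OF open_ball]) (metis assms mem_ball_0)

text \<open>Composing \<open>u \<mapsto> h u - h (\<kappa> * u)\<close> with the inverse of \<open>g\<close> gives a function on the convex
  set \<open>g ` ball 0 1\<close> with derivative \<open>(g u - g (\<kappa> * u)) / (u * deriv g u)\<close>, whose real part is
  nonnegative.\<close>

lemma primitive_quot0_contraction:
  assumes g: "convex_function g" "g 0 = 0"
    and h: "\<And>z. norm z < 1 \<Longrightarrow> (h has_field_derivative quot0 g z) (at z)"
    and \<kappa>: "norm \<kappa> \<le> 1" "\<kappa> \<noteq> 1" and z: "norm z < 1" "z \<noteq> 0"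
  shows "0 < Re ((h z - h (\<kappa> * z)) / g z)"
proof -
  note g' = convex_functionD[OF g(1)]
  obtain \<phi> where \<phi>: "\<phi> holomorphic_on g ` ball 0 1"
      "\<And>z. z \<in> ball 0 1 \<Longrightarrow> deriv g z * deriv \<phi> (g z) = 1"
      "\<And>z. z \<in> ball 0 1 \<Longrightarrow> \<phi> (g z) = z"
    using holomorphic_has_inverse[OF g'(1) open_ball g'(2)] by metis
  have gne: "g z \<noteq> 0" if "norm z < 1" "z \<noteq> 0" for z
    using quot0_nonzero[OF g that(1)] that by (auto simp: quot0_def)
  define N where "N u = h u - h (\<kappa> * u)" for u
  define N' where "N' u = quot0 g u - \<kappa> * quot0 g (\<kappa> * u)" for u
  have \<kappa>u: "norm (\<kappa> * u) < 1" if "norm u < 1" for u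
    using mult_mono[OF \<kappa>(1) order_refl, of "norm u"] that by (simp add: norm_mult)
  have N: "(N has_field_derivative N' u) (at u)" if "norm u < 1" for u
  proof -
    have "((\<lambda>u. h (\<kappa> * u)) has_field_derivative quot0 g (\<kappa> * u) * \<kappa>) (at u)"
      by (rule DERIV_chain2[where f = h and g = "\<lambda>u. \<kappa> * u", OF h[OF \<kappa>u[OF that]]])
        (auto intro!: derivative_eq_intros)
    from DERIV_diff[OF h[OF that] this] show ?thesis
      by (simp add: N_def[abs_def] N'_def mult.commute)
  qed
  have N0: "N 0 = 0" "deriv N 0 = deriv g 0 * (1 - \<kappa>)"
    using DERIV_imp_deriv[OF N[of 0]] by (simp_all add: N_def N'_def quot0_def algebra_simps)
  have N'_nn: "0 \<le> Re (N' u * deriv \<phi> (g u))" if u: "norm u < 1" for u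
  proof (cases "u = 0")
    case True
    have "deriv g 0 * deriv \<phi> (g 0) = 1" by (rule \<phi>(2)) simp
    then have "N' u * deriv \<phi> (g u) = 1 - \<kappa>"
      using True by (simp add: N'_def quot0_def algebra_simps)
    then show ?thesis using Re_one_minus_pos[OF \<kappa>] by simp
  next
    case False
    have dg: "deriv g u \<noteq> 0" using g'(5)[OF u] .
    have "deriv g u * deriv \<phi> (g u) = 1" using u by (intro \<phi>(2)) simp
    then have "deriv \<phi> (g u) = 1 / deriv g u" using dg by (simp add: eq_divide_eq mult.commute)
    moreover have "N' u = (g u - g (\<kappa> * u)) / u"
      using False g(2) by (auto simp: N'_def quot0_def diff_divide_distrib)
    ultimately have "N' u * deriv \<phi> (g u) = (g u - g (\<kappa> * u)) / (u * deriv g u)" by simp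
    then show ?thesis using convex_function_contraction[OF g(1) u False \<kappa>(1)] by simp
  qed
  have nn: "0 \<le> Re (N u / g u)" if u: "norm u < 1" "u \<noteq> 0" for u
  proof -
    have der: "((\<lambda>w. N (\<phi> w)) has_field_derivative N' (\<phi> w) * deriv \<phi> w) (at w)"
      if w: "w \<in> g ` ball 0 1" for w
    proof -
      from w obtain v where v: "norm v < 1" "w = g v" by auto
      then have "\<phi> w = v" using \<phi>(3) by auto
      then show ?thesis
        using v by (intro DERIV_chain2[OF N] holomorphic_derivI[OF \<phi>(1) g'(4)]) auto
    qed
    \<comment> \<open>The slope between \<open>0\<close> and \<open>g u\<close> of \<open>N\<close>
      composed with \<phi> is \<open>N u / g u\<close>.\<close>
    have "0 \<in> g ` ball 0 1" "g u \<in> g ` ball 0 1" "0 \<noteq> g u"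
      using g(2) u gne[OF u] by (auto intro!: image_eqI[of 0 g 0])
    from mvt_Re_slope[OF g'(3) this der] obtain c where
      c: "c \<in> g ` ball 0 1" "Re ((N (\<phi> (g u)) - N (\<phi> 0)) / (g u - 0)) = Re (N' (\<phi> c) * deriv \<phi> c)"
      by blast
    from c(1) obtain v where v: "norm v < 1" "c = g v" by auto
    have "\<phi> (g u) = u" "\<phi> 0 = 0" "\<phi> c = v"
      using \<phi>(3)[of u] \<phi>(3)[of 0] \<phi>(3)[of v] u v g(2) by auto
    then show ?thesis using c(2) N'_nn[OF v(1)] v(2) N0(1) by simp
  qed
  \<comment> \<open>\<open>Q\<close> extends \<open>N / g\<close> over the origin with value
    \<open>1 - \<kappa>\<close>, whose real part is positive; the open mapping theorem then makes
    the inequality strict everywhere.\<close>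
  define Q where "Q u = quot0 N u / quot0 g u" for u
  have Q: "Q holomorphic_on ball 0 1"
    unfolding Q_def using quot0_nonzero[OF g]
    by (intro holomorphic_intros quot0_holomorphic holomorphic_on_if_deriv[OF N] N0 g' g) auto
  have Q0: "Q 0 = 1 - \<kappa>" using g'(5)[of 0] by (simp add: Q_def quot0_def N0)
  have Qeq: "Q u = N u / g u" if "u \<noteq> 0" for u using that by (simp add: Q_def quot0_def)
  have "0 < Re (Q z)"
  proof (rule Re_pos_open_mapping[OF Q open_ball])
    show "0 \<le> Re (Q u)" if "u \<in> ball 0 1" for u
      using nn[of u] Qeq[of u] Q0 Re_one_minus_pos[OF \<kappa>] that by (cases "u = 0") auto
    show "0 < Re (Q 0)" using Q0 Re_one_minus_pos[OF \<kappa>] by simp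
  qed (use z in auto)
  then show ?thesis using Qeq[OF z(2)] by (simp add: N_def)
qed

text \<open>Of two distinct points, the one of smaller or equal modulus is
  \<open>\<kappa> * x\<close> with \<open>\<kappa> = y / x\<close>, so the strict contraction
  inequality separates their values.\<close>

lemma primitive_quot0_inj:
  assumes g: "convex_function g" "g 0 = 0"
    and h: "\<And>z. norm z < 1 \<Longrightarrow> (h has_field_derivative quot0 g z) (at z)"
  shows "inj_on h (ball 0 1)"
proof -
  have *: "h x \<noteq> h y" if "norm x < 1" "norm y \<le> norm x" "x \<noteq> y" for x y
  proof -
    have x: "x \<noteq> 0" using that by auto
    have "0 < Re ((h x - h (y / x * x)) / g x)"
      by (rule primitive_quot0_contraction[OF g h])
        (use that x in \<open>simp_all add: norm_divide divide_le_eq_1\<close>)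
    then show ?thesis using x by auto
  qed
  show ?thesis
  proof (rule inj_onI)
    fix x y assume "x \<in> ball 0 1" "y \<in> ball 0 1" "h x = h y"
    then show "x = y" using *[of x y] *[of y x] by (cases "norm y \<le> norm x") auto
  qed
qed

text \<open>Each boundary point \<open>h z\<close> with \<open>norm z = r\<close> has a supporting
  line: the contraction inequality puts the whole image strictly on one side of it. Hence no segment
  between image points can meet the frontier.\<close>

lemma primitive_quot0_convex:
  assumes g: "convex_function g" "g 0 = 0"
    and h: "\<And>z. norm z < 1 \<Longrightarrow> (h has_field_derivative quot0 g z) (at z)"
    and r: "0 < r" "r < 1"
  shows "convex (h ` ball 0 r)"
proof -
  let ?U = "h ` ball 0 r"
  have hol: "h holomorphic_on ball 0 1" by (rule holomorphic_on_if_deriv[OF h])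
  have inj: "inj_on h (ball 0 1)" by (rule primitive_quot0_inj[OF g h])
  have sub: "ball 0 r \<subseteq> ball (0::complex) 1" "cball 0 r \<subseteq> ball (0::complex) 1" using r by auto
  have op: "open ?U"
    using open_mapping_thm3[OF holomorphic_on_subset[OF hol sub(1)] open_ball inj_on_subset[OF inj sub(1)]] .
  have "compact (h ` cball 0 r)"
    using sub by (intro compact_continuous_image holomorphic_on_imp_continuous_on
        holomorphic_on_subset[OF hol]) auto
  then have cl: "closure ?U \<subseteq> h ` cball 0 r"
    by (intro closure_minimal image_mono compact_imp_closed) auto
  have "closed_segment a b \<subseteq> ?U" if ab: "a \<in> ?U" "b \<in> ?U" for a b
  proof (rule ccontr)
    assume "\<not> closed_segment a b \<subseteq> ?U"
    moreover have "a \<in> closed_segment a b \<inter> ?U" using ab by auto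
    ultimately have "closed_segment a b \<inter> frontier ?U \<noteq> {}"
      by (intro connected_Int_frontier) auto
    then obtain w where w: "w \<in> closed_segment a b" "w \<in> frontier ?U" by auto
    from w(2) op cl have "w \<in> h ` cball 0 r" "w \<notin> ?U"
      by (auto simp: frontier_def interior_open)
    then obtain z where z: "w = h z" "norm z = r" by (auto simp: le_less)
    have pos: "0 < Re ((w - x) / g z)" if x: "x \<in> ?U" for x
    proof -
      from x obtain \<zeta> where \<zeta>: "x = h \<zeta>" "norm \<zeta> < r" by auto
      have "0 < Re ((h z - h (\<zeta> / z * z)) / g z)"
        by (rule primitive_quot0_contraction[OF g h])
          (use \<zeta> z r in \<open>auto simp: norm_divide divide_le_eq_1\<close>)
      then show ?thesis using z \<zeta> r by auto
    qed
    from w(1) obtain u where u: "0 \<le> u" "u \<le> 1" "w = (1 - u) *\<^sub>R a + u *\<^sub>R b"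
      by (auto simp: in_segment)
    \<comment> \<open>The crossing point \<open>w\<close> is a convex combination of
      \<open>a\<close> and \<open>b\<close>, so the same combination of two numbers with positive
      real part would vanish.\<close>
    have "0 = (1 - u) *\<^sub>R ((w - a) / g z) + u *\<^sub>R ((w - b) / g z)"
    proof -
      have "(1 - u) *\<^sub>R (w - a) + u *\<^sub>R (w - b) = 0"
        using u(3) by (simp add: scaleR_conv_of_real algebra_simps)
      then have "((1 - u) *\<^sub>R (w - a) + u *\<^sub>R (w - b)) / g z = 0" by simp
      then show ?thesis by (simp add: add_divide_distrib scaleR_conv_of_real)
    qed
    then have "Re 0 = (1 - u) * Re ((w - a) / g z) + u * Re ((w - b) / g z)"
      by (metis plus_complex.simps(1) scaleR_complex.simps(1))
    moreover have "0 < (1 - u) * Re ((w - a) / g z) + u * Re ((w - b) / g z)"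
    proof (cases "u = 0")
      case True
      then show ?thesis using pos[OF ab(1)] by simp
    next
      case False
      then show ?thesis using u pos[OF ab(1)] pos[OF ab(2)]
        by (intro add_nonneg_pos mult_nonneg_nonneg mult_pos_pos) auto
    qed
    ultimately show False by simp
  qed
  then show ?thesis by (simp add: convex_contains_segment)
qed

text \<open>A Noshiro-Warschawski argument: on the convex image of \<open>h\<close>,
  \<open>f\<close> composed with the inverse of \<open>h\<close> has derivative of positive real
  part, so no difference quotient of it vanishes.\<close>

lemma class_C1_inj:
  assumes f: "f \<in> class_C1"
  shows "inj_on f (ball 0 1)"
proof (rule inj_onI)
  fix x y assume xy: "x \<in> ball 0 1" "y \<in> ball 0 1" "f x = f y"
  obtain g p where g: "convex_function g" "g 0 = 0" and p: "p holomorphic_on ball 0 1"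
    "\<And>z. norm z < 1 \<Longrightarrow> 0 < Re (p z)"
    and eq: "\<And>z. norm z < 1 \<Longrightarrow> deriv f z = p z * quot0 g z"
    by (rule class_C1E[OF f]) (rule that)
  have fhol: "f holomorphic_on ball 0 1" using f by (simp add: class_C1_def)
  have "quot0 g holomorphic_on ball 0 1" by (intro quot0_holomorphic convex_functionD g)
  then obtain h where h': "\<And>z. z \<in> ball 0 1 \<Longrightarrow> (h has_field_derivative quot0 g z) (at z within ball 0 1)"
    using holomorphic_convex_primitive'[of "ball 0 1" "quot0 g"] by auto
  have h: "(h has_field_derivative quot0 g z) (at z)" if "norm z < 1" for z
    using h'[of z] that by (simp add: at_within_open[of z "ball 0 1"])
  have hol: "h holomorphic_on ball 0 1" by (rule holomorphic_on_if_deriv[OF h])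
  have inj: "inj_on h (ball 0 1)" by (rule primitive_quot0_inj[OF g h])
  \<comment> \<open>Convexity is available for images of discs of radius below \<open>1\<close>, so
    a smaller disc containing both points is used.\<close>
  define r where "r = (1 + max (norm x) (norm y)) / 2"
  have r: "0 < r" "r < 1" "norm x < r" "norm y < r"
    using xy by (auto simp: r_def max_def add_pos_nonneg field_simps)
  let ?B = "ball (0::complex) r"
  have sub: "?B \<subseteq> ball 0 1" using r by auto
  have hol': "h holomorphic_on ?B" and inj': "inj_on h ?B"
    using holomorphic_on_subset[OF hol sub] inj_on_subset[OF inj sub] .
  have op: "open (h ` ?B)" by (rule open_mapping_thm3[OF hol' open_ball inj'])
  obtain \<phi> where \<phi>: "\<phi> holomorphic_on h ` ?B"
      "\<And>z. z \<in> ?B \<Longrightarrow> deriv h z * deriv \<phi> (h z) = 1"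
      "\<And>z. z \<in> ?B \<Longrightarrow> \<phi> (h z) = z"
    using holomorphic_has_inverse[OF hol' open_ball inj'] by metis
  have der: "((\<lambda>w. f (\<phi> w)) has_field_derivative p (\<phi> w)) (at w)" if w: "w \<in> h ` ?B" for w
  proof -
    from w obtain v where v: "norm v < r" "w = h v" by auto
    then have \<phi>w: "\<phi> w = v" using \<phi>(3) by auto
    have v1: "norm v < 1" using v r by simp
    have "((\<lambda>w. f (\<phi> w)) has_field_derivative deriv f v * deriv \<phi> w) (at w)"
      using v1 w by (intro DERIV_chain2[of f] holomorphic_derivI[OF \<phi>(1) op])
        (auto simp: \<phi>w intro!: holomorphic_derivI[OF fhol open_ball])
    moreover have "quot0 g v * deriv \<phi> w = 1"
      using \<phi>(2)[of v] v DERIV_imp_deriv[OF h[OF v1]] by simp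
    ultimately show ?thesis by (simp add: eq[OF v1] \<phi>w mult.assoc)
  qed
  show "x = y"
  proof (rule ccontr)
    assume "x \<noteq> y"
    then have ne: "h x \<noteq> h y" using inj_onD[OF inj _ xy(1,2)] by blast
    have "h x \<in> h ` ?B" "h y \<in> h ` ?B" using r by auto
    from mvt_Re_slope[OF primitive_quot0_convex[OF g h r(1,2)] this ne der]
    obtain c where c: "c \<in> h ` ?B"
      "Re ((f (\<phi> (h y)) - f (\<phi> (h x))) / (h y - h x)) = Re (p (\<phi> c))" by blast
    have "\<phi> (h x) = x" "\<phi> (h y) = y" using \<phi>(3) r by auto
    moreover have "norm (\<phi> c) < 1" using c(1) \<phi>(3) r by auto
    ultimately show False using c(2) p(2)[of "\<phi> c"] xy(3) by simp
  qed
qed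

section \<open>Distance to the boundary\<close>

text \<open>Needed because \<open>infdist\<close> to an empty frontier is \<open>0\<close>.\<close>

lemma inj_disc_image_ne_UNIV:
  assumes hol: "f holomorphic_on ball 0 1" and inj: "inj_on f (ball 0 1)"
  shows "f ` ball 0 1 \<noteq> UNIV"
proof
  assume U: "f ` ball 0 1 = UNIV"
  obtain \<phi> where \<phi>: "\<phi> holomorphic_on f ` ball 0 1" "\<And>z. z \<in> ball 0 1 \<Longrightarrow> \<phi> (f z) = z"
    using holomorphic_has_inverse[OF hol open_ball inj] by metis
  \<comment> \<open>The inverse would be a bounded entire function, constant by Liouville, yet it
    takes the values \<open>0\<close> and \<open>1/2\<close>.\<close>
  have "\<phi> w \<in> ball 0 1" for w
    using \<phi>(2) U by (metis UNIV_I imageE)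
  then have "bounded (range \<phi>)" by (intro bounded_subset[OF bounded_ball[of 0 1]]) auto
  then have "\<phi> constant_on UNIV" using \<phi>(1) U by (intro Liouville_theorem) auto
  then have "\<phi> (f 0) = \<phi> (f (1/2))" by (auto simp: constant_on_def)
  then show False using \<phi>(2)[of 0] \<phi>(2)[of "1/2"] by (auto simp: norm_divide)
qed

section \<open>Growth along the preimage of a segment\<close>

lemma has_real_derivative_norm:
  fixes v :: "real \<Rightarrow> 'a::real_inner"
  assumes "(v has_vector_derivative v') (at t)" "v t \<noteq> 0"
  shows "((\<lambda>t. norm (v t)) has_real_derivative inner v' (sgn (v t))) (at t)"
proof -
  have "(v has_derivative (\<lambda>h. h *\<^sub>R v')) (at t)"
    using assms(1) by (simp add: has_vector_derivative_def)
  from has_derivative_compose[OF this has_derivative_norm[OF assms(2)]]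
  show ?thesis by (simp add: has_field_derivative_def mult_commute_abs)
qed

text \<open>The primitive, vanishing at \<open>0\<close>, of the lower bound
  \<open>(1 - r) / (1 + r)\<^sup>2\<close> for \<open>norm (deriv f z)\<close>; its value at
  \<open>1\<close> is the distance \<open>1 - ln 2\<close>.\<close>

definition growth_minorant :: "real \<Rightarrow> real" where
  "growth_minorant r = 2 * r / (1 + r) - ln (1 + r)"

lemma two_over_square_minus_inverse:
  "2 / (d * d) - 1 / d = (2 - d) / d\<^sup>2" for d :: "'a::field"
  by (cases "d = 0") (simp_all add: power2_eq_square diff_divide_distrib)

lemma growth_minorant_deriv:
  assumes "0 \<le> r"
  shows "(growth_minorant has_real_derivative (1 - r) / (1 + r)\<^sup>2) (at r)"
proof -
  have "(growth_minorant has_real_derivative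
      (2 * (1 + r) - 2 * r) / ((1 + r) * (1 + r)) - 1 / (1 + r)) (at r)"
    unfolding growth_minorant_def[abs_def] using assms by (auto intro!: derivative_eq_intros)
  then show ?thesis using two_over_square_minus_inverse[of "1 + r"] by simp
qed

lemma growth_minorant_mono:
  assumes "0 \<le> x" "x \<le> y" "y \<le> 1"
  shows "growth_minorant x \<le> growth_minorant y"
proof (rule DERIV_nonneg_imp_nondecreasing[OF assms(2)])
  fix r assume r: "x \<le> r" "r \<le> y"
  then show "\<exists>d. DERIV growth_minorant r :> d \<and> 0 \<le> d"
    using assms growth_minorant_deriv[of r] by (intro exI[of _ "(1 - r) / (1 + r)\<^sup>2"]) auto
qed

lemma growth_minorant_0_1: "growth_minorant 0 = 0" "growth_minorant 1 = 1 - ln 2"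
  by (simp_all add: growth_minorant_def)

text \<open>The segment from \<open>0\<close> to \<open>w = f z\<close> is pulled back to a curve
  \<open>v\<close> with speed \<open>norm w / norm (deriv f (v t))\<close>. Hence
  \<open>growth_minorant (norm (v t))\<close> grows at rate at most \<open>norm w\<close>, and
  integrating over \<open>{0..1}\<close> gives the claim.\<close>

lemma growth_on_segment:
  assumes hol: "f holomorphic_on ball 0 1" and inj: "inj_on f (ball 0 1)" and f0: "f 0 = 0"
    and lb: "\<And>z. norm z < 1 \<Longrightarrow> (1 - norm z) / (1 + norm z)\<^sup>2 \<le> norm (deriv f z)"
    and z: "norm z < 1" and seg: "closed_segment 0 (f z) \<subseteq> f ` ball 0 1"
  shows "growth_minorant (norm z) \<le> norm (f z)"
proof (cases "z = 0")
  case True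
  then show ?thesis by (simp add: growth_minorant_0_1)
next
  case False
  define w where "w = f z"
  have w0: "w \<noteq> 0" using inj_onD[OF inj, of z 0] False z f0 by (auto simp: w_def)
  have op: "open (f ` ball 0 1)" by (rule open_mapping_thm3[OF hol open_ball inj])
  obtain \<phi> where \<phi>: "\<phi> holomorphic_on f ` ball 0 1"
      "\<And>z. z \<in> ball 0 1 \<Longrightarrow> deriv f z * deriv \<phi> (f z) = 1"
      "\<And>z. z \<in> ball 0 1 \<Longrightarrow> \<phi> (f z) = z"
    using holomorphic_has_inverse[OF hol open_ball inj] by metis
  define v where "v t = \<phi> (of_real t * w)" for t :: real
  have in_im: "of_real t * w \<in> f ` ball 0 1" if "0 \<le> t" "t \<le> 1" for t
    using seg that by (auto simp: w_def in_segment scaleR_conv_of_real intro!: subsetD[OF seg])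
  have v: "norm (v t) < 1" "f (v t) = of_real t * w" if "0 \<le> t" "t \<le> 1" for t
    using in_im[OF that] \<phi>(3) by (auto simp: v_def)
  have der: "(v has_vector_derivative w * deriv \<phi> (of_real t * w)) (at t)" if "0 \<le> t" "t \<le> 1" for t
  proof -
    have 1: "((\<lambda>t. of_real t * w) has_vector_derivative w) (at t)"
      by (auto intro!: derivative_eq_intros)
    from field_vector_diff_chain_at[OF 1 holomorphic_derivI[OF \<phi>(1) op in_im[OF that]]]
    show ?thesis by (simp add: v_def[abs_def] o_def)
  qed
  define u where "u t = growth_minorant (norm (v t)) - t * norm w" for t
  \<comment> \<open>Derivatives are taken on the open interval only, since \<open>v 0 = 0\<close>
    and the norm is not differentiable at \<open>0\<close>.\<close>
  have "u 1 \<le> u 0"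
  proof (rule DERIV_nonpos_imp_decreasing_open[where f = u and a = 0 and b = 1])
    fix t :: real assume t: "0 < t" "t < 1"
    then have vt: "norm (v t) < 1" "f (v t) = of_real t * w" using v by auto
    have v0: "v t \<noteq> 0" using vt(2) t w0 f0 by auto
    let ?d = "w * deriv \<phi> (of_real t * w)"
    let ?k = "(1 - norm (v t)) / (1 + norm (v t))\<^sup>2"
    have "((\<lambda>t. norm (v t)) has_real_derivative inner ?d (sgn (v t))) (at t)"
      using der[of t] t v0 by (intro has_real_derivative_norm) auto
    from DERIV_chain2[OF growth_minorant_deriv[OF norm_ge_zero] this]
    have D: "(u has_real_derivative ?k * inner ?d (sgn (v t)) - norm w) (at t)"
      unfolding u_def by (auto intro!: derivative_eq_intros)
    have "deriv f (v t) * deriv \<phi> (of_real t * w) = 1"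
      using \<phi>(2)[of "v t"] vt by simp
    then have n1: "norm (deriv f (v t)) * norm (deriv \<phi> (of_real t * w)) = 1"
      by (metis norm_mult norm_one)
    have "inner ?d (sgn (v t)) \<le> norm ?d * norm (sgn (v t))" by (rule norm_cauchy_schwarz)
    then have "inner ?d (sgn (v t)) \<le> norm ?d" using v0 by (simp add: norm_sgn)
    then have "?k * inner ?d (sgn (v t)) \<le> ?k * norm ?d"
      using vt by (intro mult_left_mono) auto
    also have "\<dots> \<le> norm (deriv f (v t)) * norm ?d"
      by (rule mult_right_mono[OF lb[OF vt(1)]]) simp
    also have "\<dots> = norm w * (norm (deriv f (v t)) * norm (deriv \<phi> (of_real t * w)))"
      by (simp add: norm_mult)
    finally have "?k * inner ?d (sgn (v t)) - norm w \<le> 0" by (simp add: n1)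
    with D show "\<exists>y. DERIV u t :> y \<and> y \<le> 0" by blast
  next
    have cv: "continuous_on {0..1} v"
      using der by (intro continuous_at_imp_continuous_on ballI has_vector_derivative_continuous) auto
    have "continuous_on {0..} growth_minorant"
      by (intro continuous_at_imp_continuous_on ballI DERIV_isCont[OF growth_minorant_deriv]) auto
    then have "continuous_on {0..1} (\<lambda>t. growth_minorant (norm (v t)))"
      by (rule continuous_on_compose2) (use cv in \<open>auto intro!: continuous_intros\<close>)
    then show "continuous_on {0..1} u"
      unfolding u_def by (intro continuous_intros)
  qed simp
  moreover have "v 0 = 0" "v 1 = z"
    using \<phi>(3)[of 0] \<phi>(3)[of z] z f0 by (auto simp: v_def w_def)
  ultimately show ?thesis by (simp add: u_def growth_minorant_0_1 w_def)
qed

text \<open>If a nearest frontier point \<open>w\<close> were closer than \<open>1 - ln 2\<close>,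
  the growth estimate would confine the preimages of \<open>t * w\<close>, \<open>t < 1\<close>, to
  a compact disc. Then \<open>w\<close> would lie in the open image, which is impossible.\<close>

lemma infdist_frontier_lower_bound:
  assumes hol: "f holomorphic_on ball 0 1" and inj: "inj_on f (ball 0 1)" and f0: "f 0 = 0"
    and lb: "\<And>z. norm z < 1 \<Longrightarrow> (1 - norm z) / (1 + norm z)\<^sup>2 \<le> norm (deriv f z)"
  shows "1 - ln 2 \<le> infdist 0 (frontier (f ` ball 0 1))"
proof -
  let ?U = "f ` ball 0 1"
  have op: "open ?U" by (rule open_mapping_thm3[OF hol open_ball inj])
  have 0: "0 \<in> ?U" using f0 by (auto intro!: image_eqI[of 0 f 0])
  have "frontier ?U \<noteq> {}"
    using inj_disc_image_ne_UNIV[OF hol inj] by (simp add: frontier_eq_empty)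
  then obtain w where w: "w \<in> frontier ?U" "infdist 0 (frontier ?U) = norm w"
    using infdist_attains_inf[of "frontier ?U" 0] by (auto simp: dist_norm)
  have wU: "w \<notin> ?U" using w(1) op by (simp add: frontier_def interior_open)
  have "1 - ln 2 \<le> norm w"
  proof (rule ccontr)
    assume "\<not> ?thesis"
    then have lt: "norm w < growth_minorant 1" by (simp add: growth_minorant_0_1)
    have "(growth_minorant \<longlongrightarrow> growth_minorant 1) (at_left 1)"
      using DERIV_isCont[OF growth_minorant_deriv[of 1]]
      by (auto simp: isCont_def intro: filterlim_mono[OF _ order_refl] at_le)
    then have "\<forall>\<^sub>F r in at_left 1. norm w < growth_minorant r"
      using lt by (rule order_tendstoD)
    moreover have "\<forall>\<^sub>F r in at_left (1::real). r \<in> {0<..<1}"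
      by (rule eventually_at_left_real) simp
    ultimately have "\<forall>\<^sub>F r in at_left (1::real). norm w < growth_minorant r \<and> r \<in> {0<..<1}"
      by eventually_elim simp
    then obtain \<rho> where \<rho>: "norm w < growth_minorant \<rho>" "0 < \<rho>" "\<rho> < 1"
      using eventually_happens[of _ "at_left (1::real)"] by force
    have "of_real t * w \<in> f ` cball 0 \<rho>" if t: "0 < t" "t < 1" for t :: real
    proof -
      have w0: "w \<noteq> 0" using wU 0 by auto
      \<comment> \<open>A frontier point on this segment would be nearer to \<open>0\<close> than
        the nearest one, \<open>w\<close>.\<close>
      have seg: "closed_segment 0 (of_real t * w) \<subseteq> ?U"
      proof (rule ccontr)
        assume "\<not> ?thesis"
        then have "closed_segment 0 (of_real t * w) \<inter> frontier ?U \<noteq> {}"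
          using 0 by (intro connected_Int_frontier) auto
        then obtain x where x: "x \<in> closed_segment 0 (of_real t * w)" "x \<in> frontier ?U" by auto
        have "norm x \<le> t * norm w" using segment_bound1[OF x(1)] t by (simp add: norm_mult)
        also have "\<dots> < norm w" using t w0 by simp
        finally show False using infdist_le[OF x(2), of 0] w(2) by (simp add: dist_norm)
      qed
      then have "of_real t * w \<in> ?U" by auto
      then obtain z where z: "norm z < 1" "f z = of_real t * w" by auto
      have "growth_minorant (norm z) \<le> norm (of_real t * w)"
        using growth_on_segment[OF hol inj f0 lb z(1)] seg z(2) by simp
      also have "\<dots> \<le> norm w" using t mult_left_le_one_le[of "norm w" t] by (simp add: norm_mult)
      finally have "growth_minorant (norm z) < growth_minorant \<rho>" using \<rho> by simp
      then have "norm z \<le> \<rho>" using growth_minorant_mono[of \<rho> "norm z"] \<rho> z by force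
      then show ?thesis using z(2) by (auto intro!: image_eqI[of _ f z])
    qed
    moreover have "\<forall>\<^sub>F r in at_left (1::real). r \<in> {0<..<1}"
      by (rule eventually_at_left_real) simp
    ultimately have "\<forall>\<^sub>F t in at_left (1::real). of_real t * w \<in> f ` cball 0 \<rho>"
      by (auto elim!: eventually_mono)
    moreover have "compact (f ` cball 0 \<rho>)"
      using \<rho> by (intro compact_continuous_image holomorphic_on_imp_continuous_on
          holomorphic_on_subset[OF hol]) auto
    moreover have "((\<lambda>t. of_real t * w) \<longlongrightarrow> of_real 1 * w) (at_left (1::real))"
      by (intro tendsto_intros)
    ultimately have "of_real 1 * w \<in> f ` cball 0 \<rho>"
      by (intro Lim_in_closed_set[of "f ` cball 0 \<rho>" "\<lambda>t. of_real t * w" "at_left (1::real)"])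
        (auto intro: compact_imp_closed)
    then show False using wU \<rho> by auto
  qed
  then show ?thesis using w(2) by simp
qed

section \<open>The Bohr radius\<close>

lemma majorant_sums:
  assumes "0 \<le> r" "r < (1::real)"
  shows "(\<lambda>n. (2 - 1 / real (Suc n)) * r ^ Suc n) sums (2 * r / (1 - r) + ln (1 - r))"
proof -
  have "(\<lambda>n. 2 * r * r ^ n) sums (2 * r * (1 / (1 - r)))"
    using assms by (intro sums_mult geometric_sums) auto
  moreover have "(\<lambda>n. - (r ^ n) / real n) sums ln (1 - r)"
    using ln_series'[of "- r"] assms by simp
  then have "(\<lambda>n. - (r ^ Suc n) / real (Suc n)) sums ln (1 - r)"
    by (subst sums_Suc_iff) simp
  ultimately have "(\<lambda>n. 2 * r * r ^ n + - (r ^ Suc n) / real (Suc n)) sums (2 * r * (1 / (1 - r)) + ln (1 - r))"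
    by (rule sums_add)
  then show ?thesis by (simp add: algebra_simps del: of_nat_Suc)
qed

definition majorant :: "real \<Rightarrow> real" where
  "majorant r = 2 * r / (1 - r) + ln (1 - r)"

definition majorant_tail :: "nat \<Rightarrow> real \<Rightarrow> real" where
  "majorant_tail N r = (\<Sum>n. (2 - 1 / real (n + N)) * r ^ (n + N))"

lemma radius_eq_iff: "radius_eq N r \<longleftrightarrow> majorant r + majorant_tail N r = 1 - ln 2"
  by (auto simp: radius_eq_def majorant_def majorant_tail_def)

text \<open>The summand for \<open>n = 0\<close> is \<open>2\<close>, since \<open>1 / 0 = 0\<close>; hence the constant \<open>2\<close>.\<close>

lemma majorant_tail_sums:
  assumes "0 \<le> r" "r < 1"
  shows "(\<lambda>n. (2 - 1 / real (n + N)) * r ^ (n + N)) sums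
           (majorant r + 2 - (\<Sum>i<N. (2 - 1 / real i) * r ^ i))"
proof -
  have "(\<lambda>n. (2 - 1 / real n) * r ^ n) sums (majorant r + 2)"
    using majorant_sums[OF assms] sums_Suc_iff[of "\<lambda>n. (2 - 1 / real n) * r ^ n" "majorant r"]
    by (simp add: majorant_def)
  then show ?thesis by (rule sums_split_initial_segment)
qed

lemma two_minus_inverse_nonneg: "0 \<le> 2 - 1 / real n"
  by (cases n) (auto simp: field_simps)

lemma majorant_tail_mono:
  assumes "0 \<le> r" "r \<le> s" "s < 1"
  shows "majorant_tail N r \<le> majorant_tail N s"
  unfolding majorant_tail_def
  using majorant_tail_sums[of r N] majorant_tail_sums[of s N] assms two_minus_inverse_nonneg
  by (intro suminf_le mult_left_mono power_mono) (auto simp: sums_iff simp del: of_nat_add)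

lemma majorant_tail_nonneg:
  assumes "0 \<le> r" "r < 1"
  shows "0 \<le> majorant_tail N r"
  unfolding majorant_tail_def
  using majorant_tail_sums[OF assms, of N] assms two_minus_inverse_nonneg
  by (intro suminf_nonneg mult_nonneg_nonneg) (auto simp: sums_iff simp del: of_nat_add)

lemma majorant_strict_mono:
  assumes "0 \<le> r" "r < s" "s < 1"
  shows "majorant r < majorant s"
proof (rule DERIV_pos_imp_increasing[OF assms(2)])
  fix x assume x: "r \<le> x" "x \<le> s"
  have "(majorant has_real_derivative
      (2 * (1 - x) + 2 * x) / ((1 - x) * (1 - x)) - 1 / (1 - x)) (at x)"
    unfolding majorant_def[abs_def] using x assms by (auto intro!: derivative_eq_intros)
  then have "(majorant has_real_derivative (1 + x) / (1 - x)\<^sup>2) (at x)"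
    using two_over_square_minus_inverse[of "1 - x"] by simp
  moreover have "0 < (1 + x) / (1 - x)\<^sup>2" using x assms by (intro divide_pos_pos) auto
  ultimately show "\<exists>y. DERIV majorant x :> y \<and> 0 < y" by blast
qed

lemma majorant_total_strict_mono:
  assumes "0 \<le> r" "r < s" "s < 1"
  shows "majorant r + majorant_tail N r < majorant s + majorant_tail N s"
  using majorant_strict_mono[OF assms] majorant_tail_mono[of r s N] assms by simp

section \<open>Existence and uniqueness of the radius\<close>

lemma ex1_radius:
  assumes "N \<ge> 1"
  shows "\<exists>!r. r \<in> {0<..<1} \<and> radius_eq N r"
proof -
  \<comment> \<open>Closed form of the left-hand side with a finite sum in place of the tail, which
    makes continuity immediate.\<close>
  define G where "G r = 2 * majorant r + 2 - (\<Sum>i<N. (2 - 1 / real i) * r ^ i)" for r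
  have G: "majorant r + majorant_tail N r = G r" if "0 \<le> r" "r < 1" for r
    using sums_unique[OF majorant_tail_sums[OF that, of N]] by (simp add: G_def majorant_tail_def)
  have "majorant_tail N 0 = 0" using assms by (simp add: majorant_tail_def power_0_left)
  then have "G 0 \<le> 1 - ln 2" using G[of 0] ln_2_less_1 by (simp add: majorant_def)
  \<comment> \<open>At \<open>1/2\<close> already \<open>majorant (1/2) = 2 - ln 2\<close>, and the
    tail is nonnegative.\<close>
  moreover have "1 - ln 2 \<le> G (1/2)"
    using G[of "1/2"] majorant_tail_nonneg[of "1/2" N] by (simp add: majorant_def ln_div)
  moreover have "continuous_on {0..1/2} G"
    unfolding G_def majorant_def by (intro continuous_intros) auto
  ultimately obtain r where r: "0 \<le> r" "r \<le> 1/2" "G r = 1 - ln 2"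
    using IVT'[of G 0 "1 - ln 2" "1/2"] by auto
  moreover have "r \<noteq> 0"
    using r(3) G[of 0] \<open>majorant_tail N 0 = 0\<close> ln_2_less_1 by (auto simp: majorant_def)
  ultimately have "r \<in> {0<..<1} \<and> radius_eq N r"
    using G[of r] by (auto simp: radius_eq_iff)
  moreover have "s = t" if "s \<in> {0<..<1} \<and> radius_eq N s" "t \<in> {0<..<1} \<and> radius_eq N t" for s t
    using that majorant_total_strict_mono[of s t N] majorant_total_strict_mono[of t s N]
    by (cases s t rule: linorder_cases) (auto simp: radius_eq_iff)
  ultimately show ?thesis by blast
qed

lemma r1_props:
  assumes "N \<ge> 1"
  shows "0 < r1 N" "r1 N < 1" "majorant (r1 N) + majorant_tail N (r1 N) = 1 - ln 2"
  using theI'[OF ex1_radius[OF assms]] by (auto simp: r1_def radius_eq_iff)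

text \<open>The coefficient bounds control both terms by \<open>majorant\<close> and
  \<open>majorant_tail\<close>. Their increasing sum equals \<open>1 - ln 2\<close> at
  \<open>r1 N\<close>, which is the lower bound for the distance.\<close>

lemma class_C1_bohr:
  assumes f: "f \<in> class_C1" and N: "N \<ge> 1" and z: "norm z \<le> r1 N"
  shows "bohr_ineq N f z"
proof -
  have hol: "f holomorphic_on ball 0 1" and f0: "f 0 = 0" using f by (auto simp: class_C1_def)
  let ?r = "norm z"
  have r: "0 \<le> ?r" "?r < 1" using z r1_props[OF N] by auto
  have coeff: "norm (taylor_coeff f n * z ^ n) \<le> (2 - 1 / real n) * ?r ^ n" if "n \<ge> 1" for n
    using class_C1_coeff_bound[OF f, of "n - 1"] that
    by (simp add: norm_mult norm_power mult_right_mono)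
  have "(\<lambda>n. taylor_coeff f n * z ^ n) sums f z"
    using holomorphic_power_series[OF hol, of z] r by (simp add: taylor_coeff_def fps_expansion_def)
  then have "(\<lambda>n. taylor_coeff f (Suc n) * z ^ Suc n) sums f z"
    by (subst sums_Suc_iff) (simp add: taylor_coeff_def fps_expansion_def f0)
  then have 1: "norm (f z) \<le> majorant ?r"
    using majorant_sums[OF r] coeff unfolding majorant_def by (rule norm_sums_le) simp
  have ts: "summable (\<lambda>n. (2 - 1 / real (n + N)) * ?r ^ (n + N))"
    using majorant_tail_sums[OF r, of N] by (simp add: sums_iff)
  have le: "norm (taylor_coeff f (n + N) * z ^ (n + N)) \<le> (2 - 1 / real (n + N)) * ?r ^ (n + N)" for n
    using N by (intro coeff) simp
  have "summable (\<lambda>n. norm (taylor_coeff f (n + N) * z ^ (n + N)))"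
    by (rule summable_comparison_test'[OF ts, of 0]) (use le in simp)
  then have 2: "(\<Sum>n. norm (taylor_coeff f (n + N) * z ^ (n + N))) \<le> majorant_tail N ?r"
    unfolding majorant_tail_def using le ts by (intro suminf_le) auto
  have "majorant ?r + majorant_tail N ?r \<le> majorant (r1 N) + majorant_tail N (r1 N)"
    using majorant_total_strict_mono[of ?r "r1 N" N] z r r1_props[OF N]
    by (cases "?r = r1 N") auto
  also have "\<dots> = 1 - ln 2" by (rule r1_props[OF N])
  also have "\<dots> \<le> infdist 0 (frontier (f ` ball 0 1))"
    using infdist_frontier_lower_bound[OF hol class_C1_inj[OF f] f0 class_C1_deriv_lower_bound[OF f]] by blast
  finally show ?thesis using 1 2 by (simp add: bohr_ineq_def f0)
qed

section \<open>The extremal function\<close>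

text \<open>The member of the class with \<open>g z = z / (1 - z)\<close> and
  \<open>p z = (1 + z) / (1 - z)\<close>; its coefficients attain the bound
  \<open>2 - 1/n\<close>.\<close>

definition extremal :: "complex \<Rightarrow> complex" where
  "extremal z = 2 * z / (1 - z) + ln (1 - z)"

lemma extremal_deriv:
  assumes "norm z < 1"
  shows "(extremal has_field_derivative (1 + z) / (1 - z)\<^sup>2) (at z)"
proof -
  have 1: "1 - z \<notin> \<real>\<^sub>\<le>\<^sub>0"
    using assms complex_Re_le_cmod[of z] by (auto simp: complex_nonpos_Reals_iff)
  then have "1 - z \<noteq> 0" by auto
  with 1 have "(extremal has_field_derivative
      (2 * (1 - z) + 2 * z) / ((1 - z) * (1 - z)) - 1 / (1 - z)) (at z)"
    unfolding extremal_def[abs_def]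
    by (auto intro!: derivative_eq_intros simp: inverse_eq_divide)
  then show ?thesis using two_over_square_minus_inverse[of "1 - z"] by simp
qed

text \<open>The image is the half-plane \<open>Re w > - 1 / 2\<close>, with inverse map
  \<open>w / (1 + w)\<close>.\<close>

lemma convex_function_moebius: "convex_function (\<lambda>z. z / (1 - z))"
proof -
  have ne: "1 - z \<noteq> 0" if "norm z < 1" for z :: complex using that by auto
  have "(\<lambda>z. z / (1 - z)) ` ball 0 1 = {w::complex. Re w > - 1 / 2}"
  proof (intro equalityI subsetI)
    fix w :: complex assume "w \<in> (\<lambda>z. z / (1 - z)) ` ball 0 1"
    then obtain z where z: "norm z < 1" "w = z / (1 - z)" by auto
    have "norm (1 - 1 / (1 / (1 - z))) < 1" using z by simp
    from Re_gt_half[OF this] have "0 < Re (2 * (1 / (1 - z)) - 1)" using ne[OF z(1)] by simp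
    moreover have "2 * (1 / (1 - z)) - 1 = 2 * w + 1"
      unfolding z(2) using ne[OF z(1)] by (simp add: field_simps)
    ultimately show "w \<in> {w. Re w > - 1 / 2}" by simp
  next
    fix w :: complex assume w: "w \<in> {w. Re w > - 1 / 2}"
    then have w1: "1 + w \<noteq> 0" by (auto simp: complex_eq_iff)
    have "(norm w)\<^sup>2 < (norm (1 + w))\<^sup>2"
      using w by (simp add: cmod_power2) (simp add: power2_eq_square algebra_simps)
    then have "norm (w / (1 + w)) < 1"
      using w1 by (simp add: norm_divide power2_less_imp_less)
    moreover have "w = w / (1 + w) / (1 - w / (1 + w))" using w1 by (simp add: field_simps)
    ultimately show "w \<in> (\<lambda>z. z / (1 - z)) ` ball 0 1" by (intro image_eqI[of _ _ "w / (1 + w)"]) auto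
  qed
  moreover have "inj_on (\<lambda>z::complex. z / (1 - z)) (ball 0 1)"
    by (rule inj_onI) (use ne in \<open>auto simp: frac_eq_eq algebra_simps\<close>)
  moreover have "(\<lambda>z::complex. z / (1 - z)) holomorphic_on ball 0 1"
    using ne by (intro holomorphic_intros) auto
  ultimately show ?thesis by (simp add: convex_function_def convex_halfspace_Re_gt)
qed

lemma extremal_class_C1: "extremal \<in> class_C1"
proof -
  have ne: "1 - z \<noteq> 0" if "norm z < 1" for z :: complex using that by auto
  have d: "deriv extremal z = (1 + z) / (1 - z)\<^sup>2" if "norm z < 1" for z
    by (rule DERIV_imp_deriv[OF extremal_deriv[OF that]])
  have dg: "deriv (\<lambda>z::complex. z / (1 - z)) 0 = 1"
    by (rule DERIV_imp_deriv) (auto intro!: derivative_eq_intros)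
  have p: "0 < Re ((1 + z) / (1 - z))" if z: "norm z < 1" for z :: complex
  proof -
    have "norm (1 - 1 / (1 / (1 - z))) < 1" using z by simp
    from Re_gt_half[OF this] have "0 < Re (2 * (1 / (1 - z)) - 1)" using ne[OF z] by simp
    moreover have "2 * (1 / (1 - z)) - 1 = (1 + z) / (1 - z)" using ne[OF z] by (simp add: field_simps)
    ultimately show ?thesis by (simp only:)
  qed
  have hol: "extremal holomorphic_on ball 0 1" by (rule holomorphic_on_if_deriv[OF extremal_deriv])
  have hp: "(\<lambda>z::complex. (1 + z) / (1 - z)) holomorphic_on ball 0 1"
    using ne by (intro holomorphic_intros) auto
  have eq: "\<forall>z\<in>ball 0 1 - {0}. (1 + z) / (1 - z) = z * deriv extremal z / (z / (1 - z))"
  proof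
    fix z :: complex assume z: "z \<in> ball 0 1 - {0}"
    then have "1 - z \<noteq> 0" using ne[of z] by auto
    moreover have "a / b = z * (a / b\<^sup>2) / (z / b)" if "b \<noteq> 0" for a b
      using z that by (simp add: power2_eq_square)
    moreover have "deriv extremal z = (1 + z) / (1 - z)\<^sup>2" using z by (intro d) simp
    ultimately show "(1 + z) / (1 - z) = z * deriv extremal z / (z / (1 - z))" by metis
  qed
  show ?thesis
    unfolding class_C1_def mem_Collect_eq
  proof (intro conjI)
    show "extremal 0 = 0" "deriv extremal 0 = 1" using d[of 0] by (simp_all add: extremal_def)
  qed (rule hol, rule exI[of _ "\<lambda>z. z / (1 - z)"], rule exI[of _ "\<lambda>z. (1 + z) / (1 - z)"],
      use hp eq dg p convex_function_moebius in simp)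
qed

lemma extremal_coeff:
  assumes "n \<ge> 1"
  shows "taylor_coeff extremal n = of_real (2 - 1 / real n)"
proof -
  \<comment> \<open>Index \<open>0\<close> needs its own case: \<open>2 - 1 / real 0\<close>
    evaluates to \<open>2\<close>, while \<open>extremal 0 = 0\<close>.\<close>
  let ?F = "Abs_fps (\<lambda>n. if n = 0 then 0 else complex_of_real (2 - 1 / real n))"
  have "(\<lambda>n. fps_nth ?F n * z ^ n) sums extremal z" if z: "norm z < 1" for z
  proof -
    have "(\<lambda>n. 2 * z * z ^ n) sums (2 * z * (1 / (1 - z)))"
      using z by (intro sums_mult geometric_sums) auto
    moreover have "(\<lambda>n. - (z ^ n) / of_nat n) sums ln (1 - z)"
      using Ln_series'[of "- z"] z by simp
    then have "(\<lambda>n. - (z ^ Suc n) / of_nat (Suc n)) sums ln (1 - z)"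
      by (subst sums_Suc_iff) simp
    ultimately have "(\<lambda>n. 2 * z * z ^ n + - (z ^ Suc n) / of_nat (Suc n)) sums
        (2 * z * (1 / (1 - z)) + ln (1 - z))"
      by (rule sums_add)
    then have "(\<lambda>n. fps_nth ?F (Suc n) * z ^ Suc n) sums extremal z"
      by (simp add: extremal_def algebra_simps del: of_nat_Suc)
    then show ?thesis by (subst (asm) sums_Suc_iff) simp
  qed
  then have "extremal has_fps_expansion ?F"
    by (intro has_fps_expansionI, unfold eventually_nhds) (auto intro!: exI[of _ "ball 0 1"])
  from taylor_coeff_eqI[OF this] assms show ?thesis by simp
qed

lemma extremal_of_real: "r < 1 \<Longrightarrow> extremal (of_real r) = of_real (majorant r)"
  using Ln_of_real[of "1 - r"] by (simp add: extremal_def majorant_def)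

text \<open>If the boundary value at \<open>-1\<close> were attained inside the disc, values close to it would be
  attained twice.\<close>

lemma extremal_omits: "of_real (ln 2 - 1) \<notin> extremal ` ball 0 1"
proof
  assume "of_real (ln 2 - 1) \<in> extremal ` ball 0 1"
  then obtain z where z: "norm z < 1" "extremal z = of_real (ln 2 - 1)" by auto
  have hol: "extremal holomorphic_on ball 0 1" using extremal_class_C1 by (simp add: class_C1_def)
  have inj: "inj_on extremal (ball 0 1)" by (rule class_C1_inj[OF extremal_class_C1])
  \<comment> \<open>This radius leaves room between the disc around \<open>z\<close> and the unit
    circle, so points \<open>-t\<close> with \<open>t\<close> near \<open>1\<close> lie outside that
    disc.\<close>
  define d where "d = (1 - norm z) / 2"
  have d: "0 < d" "norm z + d < 1" using z by (auto simp: d_def field_simps)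
  have "norm x < 1" if "x \<in> ball z d" for x
    using that d norm_triangle_ineq2[of x z] by (simp add: dist_norm norm_minus_commute)
  then have sub: "ball z d \<subseteq> ball 0 1" by auto
  have op: "open (extremal ` ball z d)"
    using open_mapping_thm3[OF holomorphic_on_subset[OF hol sub] open_ball inj_on_subset[OF inj sub]] .
  have "((\<lambda>t. complex_of_real (majorant (- t))) \<longlongrightarrow> of_real (majorant (- 1))) (at_left 1)"
    unfolding majorant_def by (intro tendsto_intros) auto
  moreover have "of_real (majorant (- 1)) \<in> extremal ` ball z d"
    using z d by (auto simp: majorant_def intro!: image_eqI[of _ _ z])
  ultimately have "\<forall>\<^sub>F t in at_left 1. of_real (majorant (- t)) \<in> extremal ` ball z d"
    using op topological_tendstoD by blast
  moreover have "\<forall>\<^sub>F t in at_left (1::real). t \<in> {norm z + d<..<1}"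
    using d by (intro eventually_at_left_real)
  ultimately have "\<forall>\<^sub>F t in at_left (1::real). False"
  proof eventually_elim
    case (elim t)
    have "norm z + d < t" using elim(2) by simp
    then have "0 < t" using d norm_ge_zero[of z] by linarith
    from elim(1) obtain x where x: "x \<in> ball z d" "extremal x = extremal (of_real (- t))"
      using extremal_of_real[of "- t"] \<open>0 < t\<close> by auto
    have "x = of_real (- t)"
      using inj_onD[OF inj x(2)] x(1) sub elim(2) \<open>0 < t\<close> by auto
    then have "norm x = t" using \<open>0 < t\<close> by simp
    moreover have "norm x < norm z + d"
      using x(1) norm_triangle_ineq2[of x z] by (simp add: dist_norm norm_minus_commute)
    ultimately show False using elim(2) by simp
  qed
  then show False by simp
qed

section \<open>Sharpness of the radius\<close>

lemma extremal_infdist: "infdist 0 (frontier (extremal ` ball 0 1)) \<le> 1 - ln 2"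
proof -
  let ?w = "complex_of_real (ln 2 - 1)"
  have "extremal 0 = 0" by (simp add: extremal_def)
  then have "0 \<in> extremal ` ball 0 1" by (auto intro!: image_eqI[of 0 extremal 0])
  \<comment> \<open>The segment joins an attained value to an omitted one, so it meets the frontier
    no farther from \<open>0\<close> than \<open>?w\<close>.\<close>
  then have "closed_segment 0 ?w \<inter> frontier (extremal ` ball 0 1) \<noteq> {}"
    using extremal_omits by (intro connected_Int_frontier) auto
  then obtain x where x: "x \<in> closed_segment 0 ?w" "x \<in> frontier (extremal ` ball 0 1)" by auto
  have "norm x \<le> norm ?w" using segment_bound1[OF x(1)] by simp
  also have "norm ?w = 1 - ln 2" using ln_2_less_1 by (simp only: norm_of_real)
  finally show ?thesis using infdist_le[OF x(2), of 0] by (simp add: dist_norm)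
qed

text \<open>On the positive axis every coefficient estimate is an equality for
  \<open>extremal\<close>, so the left-hand side is the strictly increasing total, which exceeds
  \<open>1 - ln 2\<close> beyond \<open>r1 N\<close>.\<close>

lemma extremal_not_bohr:
  assumes N: "N \<ge> 1" and r: "r1 N < r" "r < 1"
  shows "\<not> bohr_ineq N extremal (of_real r)"
proof
  assume b: "bohr_ineq N extremal (of_real r)"
  have r0: "0 < r" using r r1_props[OF N] by simp
  have "norm (extremal (of_real r)) = majorant r"
    using extremal_of_real[of r] majorant_strict_mono[of 0 r] r r0 by (simp add: majorant_def[of 0])
  moreover have "norm (taylor_coeff extremal (n + N) * of_real r ^ (n + N)) =
      (2 - 1 / real (n + N)) * r ^ (n + N)" for n
    using extremal_coeff[of "n + N"] N two_minus_inverse_nonneg[of "n + N"] r0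
    by (simp add: norm_mult norm_power del: of_real_diff of_nat_add)
  ultimately have "majorant r + majorant_tail N r \<le> infdist (extremal 0) (frontier (extremal ` ball 0 1))"
    using b by (simp add: bohr_ineq_def majorant_tail_def del: of_nat_add)
  also have "\<dots> \<le> 1 - ln 2" using extremal_infdist by (simp add: extremal_def[of 0])
  also have "\<dots> < majorant r + majorant_tail N r"
    using majorant_total_strict_mono[of "r1 N" r N] r r1_props[OF N] by simp
  finally show False by simp
qed

theorem theorem2p6:
  fixes N :: nat
  assumes "N \<ge> 2"
  shows "(\<exists>!r. r \<in> {0<..<1} \<and> radius_eq N r) \<and>
         (\<forall>f\<in>class_C1. \<forall>z. norm z \<le> r1 N \<longrightarrow> bohr_ineq N f z) \<and>
         (\<forall>R>r1 N. \<not> (\<forall>f\<in>class_C1. \<forall>z. norm z < 1 \<and> norm z \<le> R \<longrightarrow> bohr_ineq N f z))"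
proof (intro conjI ballI allI impI notI)
  have N: "N \<ge> 1" using assms by simp
  show "\<exists>!r. r \<in> {0<..<1} \<and> radius_eq N r" by (rule ex1_radius[OF N])
  show "bohr_ineq N f z" if "f \<in> class_C1" "norm z \<le> r1 N" for f z
    by (rule class_C1_bohr[OF that(1) N that(2)])
  fix R assume R: "R > r1 N"
    and all: "\<forall>f\<in>class_C1. \<forall>z. norm z < 1 \<and> norm z \<le> R \<longrightarrow> bohr_ineq N f z"
  \<comment> \<open>\<open>R\<close> may be \<open>1\<close> or more, so the test point is kept
    inside the disc.\<close>
  obtain r where r: "r1 N < r" "r < min R 1"
    using dense[of "r1 N" "min R 1"] R r1_props(2)[OF N] by auto
  have "norm (complex_of_real r) = r" using r r1_props(1)[OF N] by simp
  then have "bohr_ineq N extremal (of_real r)"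
    using all extremal_class_C1 r by auto
  then show False using extremal_not_bohr[OF N] r by simp
qed

end
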